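(* Let $K\subset\mathbb{R}^6$ be an origin-symmetric convex body of revolution (around the $x_6$ axis) whose radial function $\rho_K(t)$, written as a function of $t\in[0,1]$, the cosine of the angle with the axis of revolution, is of class $C^2$ in a neighborhood of $t=1$. Let $h(x)=\int_0^x\rho_K^5(t)(x^2-t^2)\,dt$, $k(1)=\int_0^1 t^2\rho_K^5(t)\,dt$, and $r(t)=\rho_K^5(t)$. If $$h^2(1)\left(5r(1)+r'(1)\right)+24k^3(1) < 12\,h(1)\,k(1)\,r(1),$$ then the intersection body $IK$ of $K$ is not a polar zonoid.
   Context: Let $n=6$. A convex body in $\mathbb{R}^n$ is a compact convex set with nonempty interior. The radial function of an origin-symmetric convex body $K$ is $\rho_K(\xi)=\max\{\lambda\ge 0:\lambda\xi\in K\}$, $\xi\in S^{n-1}$. If $K$ is an origin-symmetric convex body of revolution around the $x_n$ axis (i.e. invariant under all rotations fixing that axis), then $\rho_K(\sqrt{1-t^2}\,\xi,t)$ is independent of $\xi\in S^{n-2}$, and one writes $\rho_K(t)=\rho_K(\sqrt{1-t^2}\,\xi,t)$ for $0\le t\le 1$; thus $t$ is the cosine of the angle with the axis of revolution, $t=1$ corresponds to the axis of revolution and $t=0$ to the equator. Primes denote derivatives with respect to $t$; since $t$ ranges over $[0,1]$, neighborhoods of $t=1$ are taken in $[0,1]$ and derivatives at $t=1$ are one-sided. Powers such as $h^2(1)$, $k^3(1)$ mean $(h(1))^2$, $(k(1))^3$. The intersection body $IK$ of $K$ is the origin-symmetric star body with radial function $\rho_{IK}(\xi)=\mathrm{Vol}_{n-1}(K\cap\xi^\perp)$,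 $\xi\in S^{n-1}$ (it is convex, by Busemann's theorem). The support function of a compact convex set $Z$ is $h_Z(x)=\sup\{\langle x,u\rangle:u\in Z\}$. A compact convex set $Z\subset\mathbb{R}^n$ is a zonoid (centered at the origin) if there is a finite non-negative even Borel measure $\mu$ on $S^{n-1}$ with $h_Z(u)=\int_{S^{n-1}}|\langle u,v\rangle|\,d\mu(v)$ for all $u\in S^{n-1}$. A convex body is a polar zonoid if it is the polar body of such a zonoid; equivalently (since $h_{L^*}=1/\rho_L$), an origin-symmetric convex body $L$ is a polar zonoid if its polar body $L^*=\{x:\langle x,y\rangle\le 1\ \forall y\in L\}$ is a zonoid. *)

theory Defs
  imports "HOL-Analysis.Analysis"
begin

section \<open>Convex bodies and radial functions\<close>

definition convex_body :: "'a::euclidean_space set \<Rightarrow> bool" where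
  "convex_body K \<longleftrightarrow> compact K \<and> convex K \<and> interior K \<noteq> {}"

definition origin_symmetric :: "'a::real_vector set \<Rightarrow> bool" where
  "origin_symmetric K \<longleftrightarrow> (\<forall>x\<in>K. - x \<in> K)"

text \<open>The supremum is a maximum when \<open>K\<close> is compact and contains the origin; see
  \<open>radial_function_attained\<close> below.\<close>

definition radial_function :: "'a::real_vector set \<Rightarrow> 'a \<Rightarrow> real" where
  "radial_function K \<xi> = Sup {l. 0 \<le> l \<and> l *\<^sub>R \<xi> \<in> K}"

lemma radial_function_attained:
  fixes K :: "'a::euclidean_space set"
  assumes "compact K" "0 \<in> K" "\<xi> \<noteq> 0"
  shows "0 \<le> radial_function K \<xi>" and "radial_function K \<xi> *\<^sub>R \<xi> \<in> K"
    and "0 \<le> l \<Longrightarrow> l *\<^sub>R \<xi> \<in> K \<Longrightarrow> l \<le> radial_function K \<xi>"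
proof -
  define S where "S = {l. 0 \<le> l \<and> l *\<^sub>R \<xi> \<in> K}"
  obtain B where B: "\<And>x. x \<in> K \<Longrightarrow> norm x \<le> B"
    using compact_imp_bounded[OF \<open>compact K\<close>] unfolding bounded_iff by blast
  have bdd: "bdd_above S"
  proof (rule bdd_aboveI)
    fix l assume "l \<in> S"
    then have "\<bar>l\<bar> * norm \<xi> \<le> B" using B[of "l *\<^sub>R \<xi>"] by (simp add: S_def)
    then show "l \<le> B / norm \<xi>" using \<open>\<xi> \<noteq> 0\<close> \<open>l \<in> S\<close> by (simp add: S_def field_simps)
  qed
  have ne: "S \<noteq> {}" using \<open>0 \<in> K\<close> by (auto simp: S_def intro: exI[of _ 0])
  have "S = {0..} \<inter> (\<lambda>l. l *\<^sub>R \<xi>) -` K" by (auto simp: S_def)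
  moreover have "closed ((\<lambda>l. l *\<^sub>R \<xi>) -` K)"
    by (intro closed_vimage compact_imp_closed assms continuous_intros)
  ultimately have "closed S" by auto
  then have "Sup S \<in> S" using closed_contains_Sup ne bdd by blast
  then show "0 \<le> radial_function K \<xi>" "radial_function K \<xi> *\<^sub>R \<xi> \<in> K"
    by (auto simp: radial_function_def S_def)
  show "l \<le> radial_function K \<xi>" if "0 \<le> l" "l *\<^sub>R \<xi> \<in> K"
    using cSup_upper[OF _ bdd, of l] that by (simp add: radial_function_def S_def)
qed

section \<open>Bodies of revolution in dimension six\<close>

text \<open>The index type \<open>6\<close> is arithmetic modulo 6, so its elements are \<open>1, 2, 3, 4, 5\<close> and
  \<open>6 = 0\<close>; the last coordinate vector is \<open>axis 6 1\<close>.\<close>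

abbreviation e6 :: "real^6" where
  "e6 \<equiv> axis 6 1"

definition body_of_revolution :: "(real^6) set \<Rightarrow> bool" where
  "body_of_revolution K \<longleftrightarrow>
     (\<forall>A. rotation_matrix A \<and> A *v e6 = e6 \<longrightarrow> (\<lambda>x. A *v x) ` K = K)"

text \<open>The radial function of a body of revolution in terms of the cosine \<open>t\<close> of the angle with
  the axis. It is evaluated at the meridian through \<open>axis 1 1\<close>; any other unit vector orthogonal
  to the axis gives the same value, see \<open>radial_profile_eq\<close> below.\<close>

definition radial_profile :: "(real^6) set \<Rightarrow> real \<Rightarrow> real" where
  "radial_profile K t = radial_function K (sqrt (1 - t\<^sup>2) *\<^sub>R axis 1 1 + t *\<^sub>R e6)"

lemma orthogonal_map_fixing_exists:
  fixes a b e :: "'a::real_inner"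
  assumes "norm a = norm b" "a \<bullet> e = 0" "b \<bullet> e = 0"
  obtains T where "orthogonal_transformation T" "T a = b" "T e = e"
proof (cases "a = b")
  case True
  then show ?thesis using that[of "\<lambda>x. x"] by simp
next
  case False
  define w where "w = a - b"
  have w0: "w \<bullet> w \<noteq> 0" using False by (simp add: w_def)
  have ab: "a \<bullet> a = b \<bullet> b" using assms(1) by (simp add: norm_eq)
  have ww: "w \<bullet> w = 2 * (a \<bullet> w)"
    by (simp add: w_def inner_diff_left inner_diff_right ab inner_commute)
  define T where "T = (\<lambda>x. x - (2 * (x \<bullet> w) / (w \<bullet> w)) *\<^sub>R w)"
  have lin: "linear T"
    by (rule linearI) (simp_all add: T_def inner_add_left algebra_simps add_divide_distrib)
  moreover have "T x \<bullet> T y = x \<bullet> y" for x y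
    using w0 by (simp add: T_def inner_diff_left inner_diff_right inner_commute field_simps)
  ultimately have "orthogonal_transformation T"
    by (simp add: orthogonal_transformation_def)
  moreover have "T a = b" using w0 by (simp add: T_def ww[symmetric]) (simp add: w_def)
  moreover have "T e = e"
    using assms by (simp add: T_def w_def inner_diff_right inner_commute)
  ultimately show ?thesis using that by blast
qed

lemma radial_profile_eq:
  fixes K :: "(real^6) set"
  assumes K: "body_of_revolution K" and \<xi>: "norm \<xi> = 1" "\<xi> $ 6 = 0"
  shows "radial_profile K t = radial_function K (sqrt (1 - t\<^sup>2) *\<^sub>R \<xi> + t *\<^sub>R e6)"
proof -
  define u :: "real^6" where "u = axis 1 1"
  have neq: "(6::6) \<noteq> 1" "(6::6) \<noteq> 2" "(1::6) \<noteq> 2" by simp_all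
  obtain T where T: "orthogonal_transformation T" "T u = \<xi>" "T e6 = e6"
  proof (rule orthogonal_map_fixing_exists[of u \<xi> e6])
    show "norm u = norm \<xi>" using \<xi> by (simp add: u_def)
    show "u \<bullet> e6 = 0" by (simp add: u_def inner_axis_axis)
    show "\<xi> \<bullet> e6 = 0" using \<xi> by (simp add: inner_axis)
  qed
  define A where "A = matrix T"
  have A: "orthogonal_matrix A" "A *v u = \<xi>" "A *v e6 = e6"
    using T by (simp_all add: A_def orthogonal_transformation_matrix)
  define D :: "real^6^6" where "D = (\<chi> i j. if i = j then (if i = 2 then - 1 else 1) else 0)"
  have Dv: "D *v x = (\<chi> i. (if i = 2 then - 1 else 1) * x $ i)" for x
    unfolding D_def matrix_vector_mult_def
    by (simp add: vec_eq_iff if_distrib[of "\<lambda>c. c * _"] cong: if_cong)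
  have Dfix: "D *v u = u" "D *v e6 = e6"
    unfolding Dv by (auto simp: vec_eq_iff u_def axis_def)
  have "transpose D = D" by (auto simp: D_def transpose_def vec_eq_iff)
  moreover have "D *v (D *v x) = x" for x by (simp add: Dv vec_eq_iff)
  then have "D ** D = mat 1"
    by (simp add: matrix_eq matrix_vector_mul_assoc[symmetric])
  ultimately have Do: "orthogonal_matrix D" by (simp add: orthogonal_matrix_def)
  have "det D = (\<Prod>i\<in>UNIV. D $ i $ i)" by (rule det_diagonal) (simp add: D_def)
  also have "\<dots> = - 1" by (simp add: D_def)
  finally have detD: "det D = - 1" .
  obtain B where B: "rotation_matrix B" "B *v u = \<xi>" "B *v e6 = e6"
  proof (cases "det A = 1")
    case True
    then show ?thesis using that[of A] A by (simp add: rotation_matrix_def)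
  next
    case False
    then have "det A = - 1" using det_orthogonal_matrix A(1) by blast
    then have "rotation_matrix (A ** D)"
      by (simp add: rotation_matrix_def orthogonal_matrix_mul A(1) Do det_mul detD)
    then show ?thesis
      using that[of "A ** D"] by (simp add: matrix_vector_mul_assoc[symmetric] Dfix A)
  qed
  have img: "(\<lambda>x. B *v x) ` K = K" using K B by (simp add: body_of_revolution_def)
  have inj: "inj (\<lambda>x. B *v x)"
    using B(1) by (metis rotation_matrix_def orthogonal_matrix_def inj_matrix_vector_mult
        invertible_def)
  have mem: "B *v x \<in> K \<longleftrightarrow> x \<in> K" for x
    using img inj by (metis image_iff injD)
  have "B *v (l *\<^sub>R (sqrt (1 - t\<^sup>2) *\<^sub>R u + t *\<^sub>R e6)) = l *\<^sub>R (sqrt (1 - t\<^sup>2) *\<^sub>R \<xi> + t *\<^sub>R e6)" for l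
    by (simp add: matrix_vector_right_distrib matrix_vector_mult_scaleR B)
  then have "l *\<^sub>R (sqrt (1 - t\<^sup>2) *\<^sub>R u + t *\<^sub>R e6) \<in> K \<longleftrightarrow>
      l *\<^sub>R (sqrt (1 - t\<^sup>2) *\<^sub>R \<xi> + t *\<^sub>R e6) \<in> K" for l
    by (metis mem)
  then show ?thesis by (simp add: radial_profile_def radial_function_def u_def)
qed

text \<open>The derivatives are taken within \<open>S\<close>, hence one-sided at the end points of an interval.\<close>

definition C2_on :: "(real \<Rightarrow> real) \<Rightarrow> real set \<Rightarrow> bool" where
  "C2_on f S \<longleftrightarrow> (\<exists>f' f''.
     (\<forall>t\<in>S. (f has_real_derivative f' t) (at t within S)) \<and>
     (\<forall>t\<in>S. (f' has_real_derivative f'' t) (at t within S)) \<and>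
     continuous_on S f'')"

section \<open>Intersection bodies\<close>

definition orth_complement :: "real^6 \<Rightarrow> (real^6) set" where
  "orth_complement \<xi> = {x. \<xi> \<bullet> x = 0}"

definition hyperplane_isometry :: "real^6 \<Rightarrow> (real^5 \<Rightarrow> real^6) \<Rightarrow> bool" where
  "hyperplane_isometry \<xi> f \<longleftrightarrow>
     linear f \<and> (\<forall>x. norm (f x) = norm x) \<and> range f = orth_complement \<xi>"

text \<open>The 5-dimensional volume of a subset \<open>A\<close> of the hyperplane orthogonal to \<open>\<xi>\<close> is the Lebesgue
  measure of \<open>A\<close> transported to \<open>\<real>\<^sup>5\<close> by a linear isometry. Such an isometry exists, and the choice is
  irrelevant for compact \<open>A\<close>; see \<open>hyperplane_isometry_exists\<close> and \<open>hyperplane_volume_eq\<close>.\<close>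

definition hyperplane_volume :: "real^6 \<Rightarrow> (real^6) set \<Rightarrow> real" where
  "hyperplane_volume \<xi> A = measure lebesgue ((SOME f. hyperplane_isometry \<xi> f) -` A)"

lemma hyperplane_isometry_exists:
  assumes "\<xi> \<noteq> 0"
  shows "\<exists>f. hyperplane_isometry \<xi> f"
proof -
  have "dim (UNIV :: (real^5) set) = dim (orth_complement \<xi>)"
    using assms by (simp add: orth_complement_def dim_hyperplane dim_UNIV)
  moreover have "subspace (orth_complement \<xi>)"
    by (simp add: orth_complement_def subspace_hyperplane)
  ultimately obtain f :: "real^5 \<Rightarrow> real^6" where
    "linear f" "range f = orth_complement \<xi>" "\<And>x. norm (f x) = norm x"
    using isometries_subspaces[OF subspace_UNIV] by (metis UNIV_I)
  then show ?thesis unfolding hyperplane_isometry_def by blast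
qed

lemma hyperplane_volume_eq:
  assumes f: "hyperplane_isometry \<xi> f" and A: "compact A"
  shows "hyperplane_volume \<xi> A = measure lebesgue (f -` A)"
proof -
  define g where "g = (SOME g. hyperplane_isometry \<xi> g)"
  have g: "hyperplane_isometry \<xi> g" unfolding g_def using f by (rule someI[of "hyperplane_isometry \<xi>"])
  have f': "linear f" "\<And>x. norm (f x) = norm x" "range f = orth_complement \<xi>"
    and g': "linear g" "\<And>x. norm (g x) = norm x" "range g = orth_complement \<xi>"
    using f g by (auto simp: hyperplane_isometry_def)
  have "inj f"
    using f'(1,2) by (metis linear_injective_0 norm_eq_zero)
  define T where "T = inv f \<circ> g"
  have fT: "f (T x) = g x" for x
    using f_inv_into_f[of "g x" f UNIV] f'(3) g'(3) by (auto simp: T_def)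
  have "linear T"
  proof (rule linearI)
    show "T (x + y) = T x + T y" for x y
      by (rule injD[OF \<open>inj f\<close>]) (simp add: fT linear_add[OF f'(1)] linear_add[OF g'(1)])
    show "T (c *\<^sub>R x) = c *\<^sub>R T x" for c x
      by (rule injD[OF \<open>inj f\<close>]) (simp add: fT linear_scale[OF f'(1)] linear_scale[OF g'(1)])
  qed
  moreover have "norm (T x) = norm x" for x
    by (metis f'(2) fT g'(2))
  ultimately have T: "orthogonal_transformation T"
    by (simp add: orthogonal_transformation)
  have "f -` A = T ` (g -` A)"
  proof -
    have surj: "surj T" using T orthogonal_transformation_surj by blast
    have "T ` (T -` (f -` A)) = f -` A" by (rule surj_image_vimage_eq[OF surj])
    moreover have "T -` (f -` A) = g -` A" by (simp add: vimage_def fT)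
    ultimately show ?thesis by simp
  qed
  moreover have "g -` A \<in> lmeasurable"
  proof -
    have "closed (g -` A)"
    proof (rule closed_vimage)
      show "closed A" using A by (rule compact_imp_closed)
      show "continuous_on UNIV g"
        using g'(1) by (simp add: linear_conv_bounded_linear linear_continuous_on)
    qed
    moreover have "bounded (g -` A)"
    proof -
      obtain B where "\<And>x. x \<in> A \<Longrightarrow> norm x \<le> B"
        using compact_imp_bounded[OF A] unfolding bounded_iff by blast
      then have "norm x \<le> B" if "x \<in> g -` A" for x
        using that g'(2)[of x] by force
      then show ?thesis unfolding bounded_iff by blast
    qed
    ultimately show ?thesis
      using compact_eq_bounded_closed lmeasurable_compact by blast
  qed
  ultimately show ?thesis
    using measure_orthogonal_image[OF T]
    by (simp add: hyperplane_volume_def g_def)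
qed

definition intersection_body :: "(real^6) set \<Rightarrow> (real^6) set" where
  "intersection_body K =
     {l *\<^sub>R \<xi> | l \<xi>. norm \<xi> = 1 \<and> 0 \<le> l \<and> l \<le> hyperplane_volume \<xi> (K \<inter> orth_complement \<xi>)}"

section \<open>Zonoids and their polars\<close>

definition support_function :: "'a::real_inner set \<Rightarrow> 'a \<Rightarrow> real" where
  "support_function Z x = Sup {x \<bullet> u | u. u \<in> Z}"

definition polar_body :: "'a::real_inner set \<Rightarrow> 'a set" where
  "polar_body L = {x. \<forall>y\<in>L. x \<bullet> y \<le> 1}"

definition even_sphere_measure :: "'a::euclidean_space measure \<Rightarrow> bool" where
  "even_sphere_measure \<mu> \<longleftrightarrow>
     sets \<mu> = sets (restrict_space borel (sphere 0 1)) \<and> finite_measure \<mu> \<and>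
     (\<forall>A\<in>sets \<mu>. emeasure \<mu> (uminus ` A) = emeasure \<mu> A)"

definition zonoid :: "'a::euclidean_space set \<Rightarrow> bool" where
  "zonoid Z \<longleftrightarrow> compact Z \<and> convex Z \<and> Z \<noteq> {} \<and>
     (\<exists>\<mu>. even_sphere_measure \<mu> \<and>
       (\<forall>u\<in>sphere 0 1. support_function Z u = (\<integral>v. \<bar>u \<bullet> v\<bar> \<partial>\<mu>)))"

text \<open>A polar of a zonoid is automatically convex, but unbounded if the zonoid has empty interior.
  The following notion is meant for convex bodies \<open>L\<close>; an intersection body of a convex body is one
  by Busemann's theorem. Without the conjunct \<open>convex_body L\<close> the negation asserts more.\<close>

definition polar_zonoid :: "'a::euclidean_space set \<Rightarrow> bool" where
  "polar_zonoid L \<longleftrightarrow> (\<exists>Z. zonoid Z \<and> L = polar_body Z)"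

end

theory Submission
  imports Defs
begin

text \<open>
  Let \<open>L = IK\<close> be the polar of a zonoid \<open>Z\<close>, let \<open>\<rho>\<close> be the radial profile of \<open>K\<close> and \<open>r = \<rho>\<^sup>5\<close>.
  Then \<open>h\<^sub>Z = 1 / \<rho>\<^sub>L\<close> on the sphere, and at \<open>x = (\<eta>, \<surd>w)\<close>, with \<open>\<eta>\<close> a unit vector orthogonal to the
  axis, \<open>h\<^sub>Z(x) = 1 / (c S(1 + w))\<close>. Here \<open>c\<close> is a constant and \<open>S(p)\<close> is the integral of
  \<open>r(t) (1 - p t\<^sup>2)\<close> over \<open>0 \<le> t \<le> 1/\<surd>p\<close>.

  On the other hand \<open>h\<^sub>Z(x)\<close> is a mixture of the functions \<open>w \<mapsto> \<bar>\<langle>\<eta>, v'\<rangle> + v\<^sub>6 \<surd>w\<bar>\<close>. Averaged over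
  \<open>\<eta>\<close>, which does not change \<open>h\<^sub>Z(x)\<close>, such a function is a quadratic polynomial in \<open>w\<close> as long as
  \<open>v\<^sub>6\<^sup>2 w \<le> \<bar>v'\<bar>\<^sup>2\<close>, it is proportional to \<open>\<surd>w\<close> afterwards, and its second derivative is continuous and
  increasing. Hence all third differences of \<open>w \<mapsto> 1 / S(1 + w)\<close> are nonnegative. But
  \<open>S(1) = h(1)\<close>, \<open>S'(1) = - k(1)\<close>, \<open>S''(1) = r(1) / 2\<close> and \<open>S'''(1) = - (5 r(1) + r'(1)) / 4\<close>, so the
  hypothesis says exactly that the third derivative of \<open>1 / S\<close> at \<open>1\<close> is negative.
\<close>

section \<open>Volumes of bodies of revolution in dimension five\<close>

lemma linear_isometry_inner:
  fixes f :: "'a::real_inner \<Rightarrow> 'b::real_inner"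
  assumes "linear f" and norm: "\<And>x. norm (f x) = norm x"
  shows "f x \<bullet> f y = x \<bullet> y"
proof -
  have "norm (f x + f y) = norm (x + y)" using assms by (metis linear_add)
  then show ?thesis using norm by (simp add: dot_norm[of "f x"] dot_norm[of x])
qed

lemma borel_measurable_linear:
  fixes f :: "'a::euclidean_space \<Rightarrow> 'b::euclidean_space"
  assumes "linear f"
  shows "f \<in> borel_measurable borel"
  using assms by (intro borel_measurable_continuous_onI linear_continuous_on linear_conv_bounded_linear[THEN iffD1])

text \<open>A bijection of the two bases extends linearly to \<open>f\<close>. The preimage of a box
  is the box with reindexed corners and so has the same product of side lengths, and
  \<open>lborel\<close> is determined by its values on boxes.\<close>

lemma exists_isometry_distr_lborel:
  assumes dim: "DIM('a::euclidean_space) = DIM('b::euclidean_space)"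
  shows "\<exists>f::'a \<Rightarrow> 'b. linear f \<and> (\<forall>x. norm (f x) = norm x) \<and> distr lborel borel f = lborel"
proof -
  obtain g :: "'a \<Rightarrow> 'b" where g: "bij_betw g Basis Basis"
    using finite_same_card_bij[OF finite_Basis finite_Basis dim] by blast
  have gB: "g b \<in> Basis" if "b \<in> Basis" for b using g that by (auto simp: bij_betw_def)
  have ginj: "g b = g c \<longleftrightarrow> b = c" if "b \<in> Basis" "c \<in> Basis" for b c
    using g that by (auto simp: bij_betw_def inj_on_def)
  define f where "f x = (\<Sum>b\<in>Basis. (x \<bullet> b) *\<^sub>R g b)" for x
  have fg: "f x \<bullet> g b = x \<bullet> b" if "b \<in> Basis" for x b
  proof -
    have "f x \<bullet> g b = (\<Sum>c\<in>Basis. if c = b then x \<bullet> c else 0)"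
      unfolding f_def inner_sum_left
      by (rule sum.cong) (auto simp: that gB inner_Basis ginj)
    then show ?thesis using that by simp
  qed
  have lin: "linear f"
    by (rule linearI) (simp_all add: f_def inner_add_left scaleR_add_left sum.distrib scaleR_sum_right)
  have "norm (f x) = norm x" for x
  proof -
    have "f x \<bullet> f x = (\<Sum>c\<in>Basis. (f x \<bullet> c) * (f x \<bullet> c))" by (rule euclidean_inner)
    also have "\<dots> = (\<Sum>b\<in>Basis. (f x \<bullet> g b) * (f x \<bullet> g b))"
      by (rule sum.reindex_bij_betw[OF g, symmetric])
    also have "\<dots> = (\<Sum>b\<in>Basis. (x \<bullet> b) * (x \<bullet> b))" by (intro sum.cong) (auto simp: fg)
    also have "\<dots> = x \<bullet> x" by (rule euclidean_inner[symmetric])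
    finally show ?thesis by (simp add: norm_eq_sqrt_inner)
  qed
  moreover have "lborel = distr lborel borel f"
  proof (rule lborel_eqI)
    fix l u :: 'b assume le: "\<And>b. b \<in> Basis \<Longrightarrow> l \<bullet> b \<le> u \<bullet> b"
    define h where "h y = (\<Sum>b\<in>Basis. (y \<bullet> g b) *\<^sub>R b)" for y
    have hb: "h y \<bullet> b = y \<bullet> g b" if "b \<in> Basis" for y b using that by (simp add: h_def)
    have ball: "(\<forall>c\<in>Basis. P c) \<longleftrightarrow> (\<forall>b\<in>Basis. P (g b))" for P
      using bij_betw_imp_surj_on[OF g] by (metis imageE imageI)
    have vim: "f -` box l u = box (h l) (h u)"
      by (auto simp: box_def ball fg hb)
    have fm: "f \<in> borel \<rightarrow>\<^sub>M borel"
      by (rule borel_measurable_linear[OF lin])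
    have "emeasure (distr lborel borel f) (box l u) = emeasure lborel (box (h l) (h u))"
      using fm by (simp add: emeasure_distr vim)
    also have "\<dots> = (\<Prod>b\<in>Basis. (h u - h l) \<bullet> b)"
      by (rule emeasure_lborel_box) (simp add: hb le gB)
    also have "(\<Prod>b\<in>Basis. (h u - h l) \<bullet> b) = (\<Prod>b\<in>Basis. (u - l) \<bullet> g b)"
      by (intro prod.cong) (auto simp: inner_diff_left hb)
    also have "\<dots> = (\<Prod>b\<in>Basis. (u - l) \<bullet> b)"
      by (rule prod.reindex_bij_betw[OF g])
    finally show "emeasure (distr lborel borel f) (box l u) = (\<Prod>b\<in>Basis. (u - l) \<bullet> b)" .
  qed simp
  ultimately show ?thesis using lin by metis
qed

text \<open>Invariance of the measure of single sets is \<open>measure_orthogonal_image\<close>;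
  checking it on boxes gives an equality of Borel measures, the form in which integrals can be
  transformed.\<close>

lemma distr_lborel_orthogonal_transformation:
  fixes T :: "real^'n::{finite,wellorder} \<Rightarrow> real^'n::_"
  assumes T: "orthogonal_transformation T"
  shows "distr lborel borel T = lborel"
proof (rule lborel_eqI[symmetric])
  fix l u :: "real^'n::{finite,wellorder}" assume le: "\<And>b. b \<in> Basis \<Longrightarrow> l \<bullet> b \<le> u \<bullet> b"
  have Tm: "T \<in> borel \<rightarrow>\<^sub>M borel"
    using T by (simp add: borel_measurable_linear orthogonal_transformation_def)
  have bij: "bij T" using T by (rule orthogonal_transformation_bij)
  have vim: "T -` box l u = inv T ` box l u" by (rule bij_vimage_eq_inv_image[OF bij])
  have invT: "orthogonal_transformation (inv T)" using T by (rule orthogonal_transformation_inv)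
  have meas: "inv T ` box l u \<in> lmeasurable" "measure lebesgue (inv T ` box l u) = measure lebesgue (box l u)"
    using measurable_orthogonal_image[OF invT] measure_orthogonal_image[OF invT] by auto
  have "emeasure (distr lborel borel T) (box l u) = emeasure lborel (T -` box l u)"
    using Tm by (simp add: emeasure_distr)
  also have "\<dots> = emeasure lebesgue (T -` box l u)"
    using measurable_sets[OF Tm, of "box l u"] by (simp add: emeasure_completion)
  also have "\<dots> = measure lebesgue (box l u)"
    unfolding vim using emeasure_eq_measure2[OF meas(1)] meas(2) by metis
  also have "\<dots> = emeasure lborel (box l u)"
    using emeasure_eq_ennreal_measure[of lborel "box l u"] emeasure_lborel_box_finite[of l u] by simp
  finally show "emeasure (distr lborel borel T) (box l u) = (\<Prod>b\<in>Basis. (u - l) \<bullet> b)"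
    using le by simp
qed simp

text \<open>These are orthonormal coordinates of \<open>real^5\<close> with the axis
  \<open>u\<close> as last coordinate direction. They arise from any measure-preserving isometry by
  an orthogonal map that takes the image of \<open>(0, 1)\<close> to \<open>u\<close>.\<close>

lemma exists_axis_coordinates:
  fixes u :: "real^5"
  assumes "norm u = 1"
  obtains f :: "(real^4) \<times> real \<Rightarrow> real^5" where "linear f" "\<And>x. norm (f x) = norm x"
    "distr lborel borel f = lborel" "\<And>x a. u \<bullet> f (x, a) = a"
proof -
  have "DIM((real^4) \<times> real) = DIM(real^5)" by simp
  from exists_isometry_distr_lborel[OF this] obtain g :: "(real^4) \<times> real \<Rightarrow> real^5" where
    g: "linear g" "\<And>x. norm (g x) = norm x" "distr lborel borel g = lborel" by blast
  define v where "v = g (0, 1)"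
  have "norm v = norm u" using g(2) assms by (simp add: v_def)
  then obtain T where T: "orthogonal_transformation T" "T v = u"
    using orthogonal_transformation_exists[of v u] by blast
  have lT: "linear T" using T by (simp add: orthogonal_transformation_def)
  define f where "f = T \<circ> g"
  have meas: "T \<in> borel \<rightarrow>\<^sub>M borel" "g \<in> borel \<rightarrow>\<^sub>M borel"
    using lT g(1) by (simp_all add: borel_measurable_linear)
  have lf: "linear f" using g(1) lT by (simp add: f_def linear_compose)
  have nf: "norm (f x) = norm x" for x
    using g(2) T(1) by (simp add: f_def orthogonal_transformation_norm)
  note inn = linear_isometry_inner[OF lf nf]
  show thesis
  proof (rule that[OF lf nf])
    show "distr lborel borel f = lborel"
      unfolding f_def using meas
      by (subst distr_distr[of T borel borel g lborel, symmetric])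
         (auto simp: g(3) distr_lborel_orthogonal_transformation[OF T(1)])
    show "u \<bullet> f (x, a) = a" for x a
    proof -
      have "u = f (0, 1)" using T(2) by (simp add: f_def v_def)
      then show ?thesis by (simp add: inn inner_Pair)
    qed
  qed
qed

text \<open>Monotonicity of \<open>t * R t\<close> makes the slice at height \<open>a\<close> a ball. The density on the right-hand side
  is minus the derivative in \<open>t\<close> of the volume of the ball of radius \<open>\<bar>a\<bar> * sqrt (1 / t\<^sup>2 - 1)\<close>.\<close>

lemma emeasure_revolution_slice:
  fixes R :: "real \<Rightarrow> real" and a B :: real
  assumes a: "a \<noteq> 0" and mono: "mono_on {0<..1} (\<lambda>t. t * R t)"
    and B: "\<And>t. 0 < t \<Longrightarrow> t \<le> 1 \<Longrightarrow> R t \<le> B"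
  shows "emeasure lborel {x::real^4. norm (x, a) \<le> R (\<bar>a\<bar> / norm (x, a))} =
    (\<integral>\<^sup>+t. ennreal (4 * unit_ball_vol 4 * a ^ 4 * (1 - t\<^sup>2) / t ^ 5) *
       indicator {t. 0 < t \<and> t \<le> 1 \<and> \<bar>a\<bar> \<le> t * R t} t \<partial>lborel)" (is "emeasure lborel ?S = ?rhs")
proof -
  define A where "A = {t. 0 < t \<and> t \<le> 1 \<and> \<bar>a\<bar> \<le> t * R t}"
  define q where "q x = \<bar>a\<bar> / norm (x, a)" for x :: "real^4"
  have npos: "0 < norm (x, a)" for x :: "real^4" using a by (simp add: zero_prod_def)
  have nle: "\<bar>a\<bar> \<le> norm (x, a)" for x :: "real^4" by (simp add: norm_Pair real_le_rsqrt)
  have q01: "0 < q x" "q x \<le> 1" for x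
    using a npos[of x] nle[of x] by (auto simp: q_def)
  have qn: "norm (x, a) * q x = \<bar>a\<bar>" for x using npos[of x] by (simp add: q_def)
  \<comment> \<open>Multiplying by the positive cosine \<open>q x\<close> turns the radial
    inequality into a condition on \<open>q x\<close> alone.\<close>
  have S: "x \<in> ?S \<longleftrightarrow> q x \<in> A" for x
  proof -
    have "norm (x, a) \<le> R (q x) \<longleftrightarrow> norm (x, a) * q x \<le> R (q x) * q x"
      using q01[of x] by simp
    then show ?thesis using q01[of x] unfolding qn by (simp add: A_def mult.commute flip: q_def)
  qed
  show ?thesis
  proof (cases "A = {}")
    case True
    then have "?S = {}" using S by blast
    then show ?thesis using True by (simp flip: A_def)
  next
    case False
    have lower: "\<bar>a\<bar> / B \<le> t" "0 < B" if "t \<in> A" for t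
    proof -
      have "\<bar>a\<bar> \<le> t * R t" "0 < t" "t \<le> 1" using that by (auto simp: A_def)
      moreover have "t * R t \<le> t * B" using B[of t] calculation by simp
      ultimately have *: "\<bar>a\<bar> \<le> t * B" by linarith
      then have "0 < t * B" using a by linarith
      then show "0 < B" using \<open>0 < t\<close> zero_less_mult_pos by blast
      then show "\<bar>a\<bar> / B \<le> t" using * by (simp add: divide_le_eq)
    qed
    have bdd: "bdd_below A" using lower by (meson bdd_below.I)
    \<comment> \<open>By monotonicity \<open>A\<close> is an interval that reaches up to 1 and has
      lower end point \<open>t0\<close>. Its elements are at least \<open>|a| / B\<close>, which
      keeps \<open>t0\<close> positive.\<close>
    define t0 where "t0 = Inf A"
    have "0 < \<bar>a\<bar> / B" using False lower(2) a by auto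
    also have "\<bar>a\<bar> / B \<le> t0" unfolding t0_def using False lower by (intro cInf_greatest) auto
    finally have t0pos: "0 < t0" .
    have t0le: "t0 \<le> t" if "t \<in> A" for t unfolding t0_def using that bdd by (rule cInf_lower)
    have t01: "t0 \<le> 1" using False t0le by (force simp: A_def)
    have up: "t \<in> A" if "t0 < t" "t \<le> 1" for t
    proof -
      obtain s where s: "s \<in> A" "s < t" using cInf_lessD[OF False] \<open>t0 < t\<close> t0_def by blast
      have "s * R s \<le> t * R t" using s that by (intro mono_onD[OF mono]) (auto simp: A_def)
      then show ?thesis using s that by (auto simp: A_def)
    qed
    define g where "g = 1 / t0\<^sup>2 - 1"
    have g0: "0 \<le> g" using t0pos t01 by (simp add: g_def power_le_one)
    \<comment> \<open>The distance from the axis at which the cosine \<open>q x\<close> equals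
      \<open>t0\<close>.\<close>
    define \<rho> where "\<rho> = \<bar>a\<bar> * sqrt g"
    have \<rho>0: "0 \<le> \<rho>" using g0 by (simp add: \<rho>_def)
    have \<rho>2: "\<rho>\<^sup>2 = a\<^sup>2 * g" using g0 by (simp add: \<rho>_def power_mult_distrib)
    have sq: "t0\<^sup>2 * (norm (x, a))\<^sup>2 \<le> a\<^sup>2 \<longleftrightarrow> norm x \<le> \<rho>" for x :: "real^4"
    proof -
      have "norm x \<le> \<rho> \<longleftrightarrow> (norm x)\<^sup>2 \<le> a\<^sup>2 * g"
        unfolding \<rho>2[symmetric] using \<rho>0 by (simp add: power_mono_iff)
      also have "\<dots> \<longleftrightarrow> t0\<^sup>2 * ((norm x)\<^sup>2 + a\<^sup>2) \<le> a\<^sup>2"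
        using t0pos by (simp add: g_def field_simps)
      finally show ?thesis by (simp add: norm_Pair)
    qed
    have sq': "a\<^sup>2 \<le> t0\<^sup>2 * (norm (x, a))\<^sup>2 \<longleftrightarrow> \<rho> \<le> norm x" for x :: "real^4"
    proof -
      have "\<rho> \<le> norm x \<longleftrightarrow> a\<^sup>2 * g \<le> (norm x)\<^sup>2"
        unfolding \<rho>2[symmetric] using \<rho>0 by (simp add: power_mono_iff)
      also have "\<dots> \<longleftrightarrow> a\<^sup>2 \<le> t0\<^sup>2 * ((norm x)\<^sup>2 + a\<^sup>2)"
        using t0pos by (simp add: g_def field_simps)
      finally show ?thesis by (simp add: norm_Pair)
    qed
    have qle: "t0 \<le> q x \<longleftrightarrow> norm x \<le> \<rho>" for x
    proof -
      have "t0 \<le> q x \<longleftrightarrow> t0 * norm (x, a) \<le> \<bar>a\<bar>" using npos[of x] by (simp add: q_def le_divide_eq)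
      also have "\<dots> \<longleftrightarrow> (t0 * norm (x, a))\<^sup>2 \<le> \<bar>a\<bar>\<^sup>2" using t0pos by (intro power_mono_iff[symmetric]) auto
      finally show ?thesis by (simp add: power_mult_distrib sq)
    qed
    have qge: "q x \<le> t0 \<longleftrightarrow> \<rho> \<le> norm x" for x
    proof -
      have "q x \<le> t0 \<longleftrightarrow> \<bar>a\<bar> \<le> t0 * norm (x, a)" using npos[of x] by (simp add: q_def divide_le_eq)
      also have "\<dots> \<longleftrightarrow> \<bar>a\<bar>\<^sup>2 \<le> (t0 * norm (x, a))\<^sup>2" using t0pos by (intro power_mono_iff[symmetric]) auto
      finally show ?thesis by (simp add: power_mult_distrib sq')
    qed
    \<comment> \<open>Whether the slice is a closed or an open ball depends on whether the infimum
      \<open>t0\<close> is attained; its volume does not.\<close>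
    have "?S = cball 0 \<rho> \<or> ?S = ball 0 \<rho>"
    proof (cases "t0 \<in> A")
      case True
      have "q x \<in> A \<longleftrightarrow> t0 \<le> q x" for x
        using True up[of "q x"] t0le[of "q x"] q01[of x] by (metis order_le_less)
      then have "?S = cball 0 \<rho>" unfolding set_eq_iff S by (simp add: qle)
      then show ?thesis ..
    next
      case False
      have "q x \<in> A \<longleftrightarrow> \<not> q x \<le> t0" for x
        using False up[of "q x"] t0le[of "q x"] q01[of x] by (metis leI order_antisym)
      then have "?S = ball 0 \<rho>" unfolding set_eq_iff S by (simp add: qge not_le)
      then show ?thesis ..
    qed
    then have lhs: "emeasure lborel ?S = ennreal (unit_ball_vol 4 * \<rho> ^ 4)"
      using \<rho>0 by (auto simp: emeasure_ball emeasure_cball)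
    let ?f = "\<lambda>t. 4 * unit_ball_vol 4 * a ^ 4 * (1 - t\<^sup>2) / t ^ 5"
    let ?F = "\<lambda>t. - (unit_ball_vol 4 * a ^ 4 * (1 / t\<^sup>2 - 1)\<^sup>2)"
    have "?rhs = (\<integral>\<^sup>+t. ennreal (?f t) * indicator {t0..1} t \<partial>lborel)"
    proof (rule nn_integral_cong_AE)
      have "AE t in lborel. t \<noteq> t0" by (rule AE_lborel_singleton)
      then show "AE t in lborel. ennreal (?f t) * indicator {t. 0 < t \<and> t \<le> 1 \<and> \<bar>a\<bar> \<le> t * R t} t
          = ennreal (?f t) * indicator {t0..1} t"
      proof eventually_elim
        case (elim t)
        have "t \<in> A \<longleftrightarrow> t \<in> {t0..1}" using elim up[of t] t0le[of t] by (auto simp: A_def)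
        then show ?case by (auto simp: indicator_def simp flip: A_def)
      qed
    qed
    also have "\<dots> = ?F 1 - ?F t0"
    proof (rule nn_integral_FTC_Icc)
      show "?f \<in> borel_measurable borel" by measurable
      fix t assume "t \<in> {t0..1}"
      then have t: "t0 \<le> t" "t \<le> 1" by auto
      then have "0 < t" using t0pos by linarith
      then show "(?F has_real_derivative ?f t) (at t)"
        by (auto intro!: derivative_eq_intros simp: field_simps power2_eq_square eval_nat_numeral)
      show "0 \<le> ?f t" using t \<open>0 < t\<close> by (simp add: power_le_one)
    qed (rule t01)
    also have "?F 1 - ?F t0 = unit_ball_vol 4 * \<rho> ^ 4"
    proof -
      have "\<rho> ^ 4 = (\<rho>\<^sup>2)\<^sup>2" by simp
      also have "\<dots> = a ^ 4 * g\<^sup>2" unfolding \<rho>2 by (simp add: power_mult_distrib)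
      finally show ?thesis by (simp add: g_def)
    qed
    finally show ?thesis using lhs by simp
  qed
qed

lemma nn_integral_power4:
  assumes "0 \<le> b"
  shows "(\<integral>\<^sup>+a. ennreal (a ^ 4) * indicator {a. \<bar>a\<bar> \<le> b} a \<partial>lborel) = ennreal (2 / 5 * b ^ 5)"
proof -
  have "{a. \<bar>a\<bar> \<le> b} = {-b..b}" by auto
  moreover have "(\<integral>\<^sup>+a. ennreal (a ^ 4) * indicator {-b..b} a \<partial>lborel) = b ^ 5 / 5 - (- b) ^ 5 / 5"
    using assms by (intro nn_integral_FTC_Icc) (auto intro!: derivative_eq_intros)
  ultimately show ?thesis by (simp add: field_simps)
qed

text \<open>Three halves of the volume of the unit ball of dimension five.\<close>

definition rev_const :: real where "rev_const = 8 / 5 * unit_ball_vol 4"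

lemma rev_const_pos: "0 < rev_const" by (simp add: rev_const_def)

text \<open>The body is cut into slices of constant height \<open>a\<close> and the two integrations
  are exchanged. For fixed \<open>t\<close> the condition \<open>|a| <= t * R t\<close> leaves the
  integral of \<open>a ^ 4\<close>, which is \<open>2 / 5 * (t * R t) ^ 5\<close>; its factor
  \<open>t ^ 5\<close> cancels the denominator of the density.\<close>

lemma emeasure_revolution_prod:
  fixes R :: "real \<Rightarrow> real" and B :: real
  assumes R[measurable]: "R \<in> borel_measurable borel" and mono: "mono_on {0<..1} (\<lambda>t. t * R t)"
    and B: "\<And>t. 0 < t \<Longrightarrow> t \<le> 1 \<Longrightarrow> R t \<le> B" and nn: "\<And>t. 0 \<le> R t"
  shows "emeasure lborel {z::(real^4) \<times> real. snd z \<noteq> 0 \<and> norm z \<le> R (\<bar>snd z\<bar> / norm z)} =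
    (\<integral>\<^sup>+t. ennreal (rev_const * (R t ^ 5 * (1 - t\<^sup>2))) * indicator {0<..1} t \<partial>lborel)"
proof -
  let ?S = "{z::(real^4) \<times> real. snd z \<noteq> 0 \<and> norm z \<le> R (\<bar>snd z\<bar> / norm z)}"
  let ?f = "\<lambda>a t. ennreal (4 * unit_ball_vol 4 * a ^ 4 * (1 - t\<^sup>2) / t ^ 5) *
       indicator {t. 0 < t \<and> t \<le> 1 \<and> \<bar>a\<bar> \<le> t * R t} t"
  have [measurable]: "(snd :: (real^4) \<times> real \<Rightarrow> real) \<in> borel_measurable borel"
    by (intro borel_measurable_continuous_onI continuous_intros)
  have Sm: "?S \<in> sets borel" by measurable
  have Sm': "?S \<in> sets ((lborel :: (real^4) measure) \<Otimes>\<^sub>M (lborel :: real measure))"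
    unfolding lborel_prod using Sm by (simp only: sets_lborel)
  have "emeasure lborel ?S = emeasure ((lborel :: (real^4) measure) \<Otimes>\<^sub>M (lborel :: real measure)) ?S"
    by (simp add: lborel_prod)
  also have "\<dots> = (\<integral>\<^sup>+a. emeasure lborel ((\<lambda>x. (x, a)) -` ?S) \<partial>lborel)"
    by (rule lborel_pair.emeasure_pair_measure_alt2[OF Sm'])
  also have "\<dots> = (\<integral>\<^sup>+a. \<integral>\<^sup>+t. ?f a t \<partial>lborel \<partial>lborel)"
  proof (rule nn_integral_cong_AE)
    have "AE a in lborel. a \<noteq> (0::real)" by (rule AE_lborel_singleton)
    then show "AE a in lborel. emeasure lborel ((\<lambda>x. (x, a)) -` ?S) = (\<integral>\<^sup>+t. ?f a t \<partial>lborel)"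
    proof eventually_elim
      case (elim a)
      then have "(\<lambda>x. (x, a)) -` ?S = {x. norm (x, a) \<le> R (\<bar>a\<bar> / norm (x, a))}" by auto
      then show ?case using emeasure_revolution_slice[OF elim mono B] by simp
    qed
  qed
  also have "\<dots> = (\<integral>\<^sup>+t. \<integral>\<^sup>+a. ?f a t \<partial>lborel \<partial>lborel)"
    by (rule lborel_pair.Fubini') measurable
  also have "\<dots> = (\<integral>\<^sup>+t. ennreal (rev_const * (R t ^ 5 * (1 - t\<^sup>2))) * indicator {0<..1} t \<partial>lborel)"
  proof (rule nn_integral_cong)
    fix t :: real
    show "(\<integral>\<^sup>+a. ?f a t \<partial>lborel) = ennreal (rev_const * (R t ^ 5 * (1 - t\<^sup>2))) * indicator {0<..1} t"
    proof (cases "0 < t \<and> t \<le> 1")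
      case True
      define k where "k = 4 * unit_ball_vol 4 * (1 - t\<^sup>2) / t ^ 5"
      have k: "0 \<le> k" using True by (simp add: k_def power_le_one)
      have "(\<integral>\<^sup>+a. ?f a t \<partial>lborel) = (\<integral>\<^sup>+a. ennreal k * (ennreal (a ^ 4) * indicator {a. \<bar>a\<bar> \<le> t * R t} a) \<partial>lborel)"
        using True k by (intro nn_integral_cong) (auto simp: k_def indicator_def algebra_simps simp flip: ennreal_mult)
      also have "\<dots> = ennreal k * ennreal (2 / 5 * (t * R t) ^ 5)"
        using True nn[of t] by (subst nn_integral_cmult) (auto simp: nn_integral_power4)
      also have "\<dots> = ennreal (rev_const * (R t ^ 5 * (1 - t\<^sup>2)))"
        using True k nn[of t] by (subst ennreal_mult[symmetric]) (auto simp: k_def rev_const_def power_mult_distrib mult_ac)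
      finally show ?thesis using True by simp
    next
      case False
      then show ?thesis by (auto simp: indicator_def)
    qed
  qed
  finally show ?thesis .
qed

lemma AE_lborel_inner_nonzero:
  fixes u :: "'a::euclidean_space"
  assumes "u \<noteq> 0"
  shows "AE y in lborel. u \<bullet> y \<noteq> 0"
proof -
  have "negligible {y. u \<bullet> y = 0}" using assms by (intro negligible_hyperplane) simp
  moreover have "{y. u \<bullet> y = 0} \<in> sets borel" by measurable
  ultimately have "{y. u \<bullet> y = 0} \<in> null_sets lborel"
    by (simp add: negligible_iff_null_sets null_sets_completion_iff)
  then have "AE y in lborel. y \<notin> {y. u \<bullet> y = 0}" by (rule AE_not_in)
  then show ?thesis by simp
qed

text \<open>A monotone function is Borel measurable, and dividing by \<open>t\<close> recovers
  \<open>R\<close>. This supplies the measurability of radial profiles without any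
  continuity.\<close>

lemma borel_measurable_if_mono_times_id:
  fixes R :: "real \<Rightarrow> real"
  assumes "mono_on {0<..1} (\<lambda>t. t * R t)"
  shows "(\<lambda>t. if t \<in> {0<..1} then R t else 0) \<in> borel_measurable borel"
proof -
  have "(\<lambda>t. t * R t) \<in> borel_measurable (restrict_space borel {0<..1})"
    by (rule borel_measurable_mono_on_fnc[OF assms])
  then have "(\<lambda>t. indicator {0<..1} t *\<^sub>R (t * R t)) \<in> borel_measurable borel"
    by (subst (asm) borel_measurable_restrict_space_iff) auto
  then have "(\<lambda>t. (indicator {0<..1} t *\<^sub>R (t * R t)) / t) \<in> borel_measurable borel"
    by measurable
  also have "(\<lambda>t. (indicator {0<..1} t *\<^sub>R (t * R t)) / t) = (\<lambda>t. if t \<in> {0<..1} then R t else 0)"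
    by auto
  finally show ?thesis .
qed

text \<open>Coordinates along \<open>u\<close> reduce this to the product formula. The hyperplane
  orthogonal to \<open>u\<close>, where the cosine is 0, is a null set, so \<open>R 0\<close>
  affects neither the volume nor the integral.\<close>

lemma has_integral_measure_revolution:
  fixes R :: "real \<Rightarrow> real" and u :: "real^5"
  assumes u: "norm u = 1" and mono: "mono_on {0<..1} (\<lambda>t. t * R t)"
    and B: "\<And>t. 0 < t \<Longrightarrow> t \<le> 1 \<Longrightarrow> R t \<le> B" and nn: "\<And>t. 0 < t \<Longrightarrow> t \<le> 1 \<Longrightarrow> 0 \<le> R t"
  shows "{y. norm y \<le> R (\<bar>u \<bullet> y\<bar> / norm y)} \<in> sets borel" (is "?S \<in> _")
    and "((\<lambda>t. R t ^ 5 * (1 - t\<^sup>2)) has_integral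
           measure lborel {y. norm y \<le> R (\<bar>u \<bullet> y\<bar> / norm y)} / rev_const) {0..1}"
    and "emeasure lborel {y. norm y \<le> R (\<bar>u \<bullet> y\<bar> / norm y)} < \<infinity>"
proof -
  \<comment> \<open>The cut-off outside \<open>{0<..1}\<close> makes the function Borel measurable
    and nonnegative on the whole line, as the product formula requires.\<close>
  define R' where "R' t = (if t \<in> {0<..1} then R t else 0)" for t
  have R'[measurable]: "R' \<in> borel_measurable borel"
    unfolding R'_def[abs_def] by (rule borel_measurable_if_mono_times_id[OF mono])
  have nn': "0 \<le> R' t" for t using nn by (simp add: R'_def)
  have mono': "mono_on {0<..1} (\<lambda>t. t * R' t)"
    using mono by (auto simp: R'_def mono_on_def)
  have B': "R' t \<le> B" if "0 < t" "t \<le> 1" for t using B that by (simp add: R'_def)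
  define S' where "S' = {y. u \<bullet> y \<noteq> 0 \<and> norm y \<le> R' (\<bar>u \<bullet> y\<bar> / norm y)}"
  have S'm[measurable]: "S' \<in> sets borel" unfolding S'_def by measurable
  have q: "0 < \<bar>u \<bullet> y\<bar> / norm y" "\<bar>u \<bullet> y\<bar> / norm y \<le> 1" if "u \<bullet> y \<noteq> 0" for y
    using that Cauchy_Schwarz_ineq2[of u y] u by (auto simp: divide_le_eq intro!: divide_pos_pos)
  have SS': "y \<in> ?S \<longleftrightarrow> y \<in> S'" if "u \<bullet> y \<noteq> 0" for y
    using q[OF that] that by (auto simp: S'_def R'_def)
  have "?S = S' \<union> {y. u \<bullet> y = 0 \<and> norm y \<le> R 0}"
    (is "_ = S' \<union> ?N")
  proof -
    have "y \<in> ?S \<longleftrightarrow> y \<in> S' \<union> ?N" for y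
    proof (cases "u \<bullet> y = 0")
      case True
      then show ?thesis by (simp add: S'_def)
    next
      case False
      then show ?thesis using SS'[OF False] by simp
    qed
    then show ?thesis by blast
  qed
  also have "\<dots> \<in> sets borel" by measurable
  finally show Sm: "?S \<in> sets borel" .
  have "AE y in lborel. y \<in> ?S \<longleftrightarrow> y \<in> S'"
    using u by (intro AE_lborel_inner_nonzero[THEN eventually_mono] SS') auto
  then have eqS: "emeasure lborel ?S = emeasure lborel S'"
    by (rule emeasure_eq_AE) (use Sm in auto)
  obtain f :: "(real^4) \<times> real \<Rightarrow> real^5" where f: "linear f" "\<And>x. norm (f x) = norm x"
    "distr lborel borel f = lborel" "\<And>x a. u \<bullet> f (x, a) = a"
    using exists_axis_coordinates[OF u] by metis
  have [measurable]: "f \<in> borel \<rightarrow>\<^sub>M borel" by (rule borel_measurable_linear[OF f(1)])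
  have uf: "u \<bullet> f z = snd z" for z using f(4)[of "fst z" "snd z"] by simp
  have "emeasure lborel S' = emeasure lborel (f -` S')"
    by (subst f(3)[symmetric]) (simp add: emeasure_distr)
  also have "f -` S' = {z. snd z \<noteq> 0 \<and> norm z \<le> R' (\<bar>snd z\<bar> / norm z)}"
    by (auto simp: S'_def f(2) uf)
  also have "emeasure lborel \<dots> = (\<integral>\<^sup>+t. ennreal (rev_const * (R' t ^ 5 * (1 - t\<^sup>2))) * indicator {0<..1} t \<partial>lborel)"
    by (rule emeasure_revolution_prod[OF R' mono' B' nn'])
  also have "\<dots> = (\<integral>\<^sup>+t. ennreal (rev_const * (R' t ^ 5 * (1 - t\<^sup>2)) * indicator {0<..1} t) \<partial>lborel)"
    by (intro nn_integral_cong) (auto simp: indicator_def)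
  finally have vol: "emeasure lborel S' = (\<integral>\<^sup>+t. ennreal (rev_const * (R' t ^ 5 * (1 - t\<^sup>2)) * indicator {0<..1} t) \<partial>lborel)" .
  have "S' \<subseteq> ball 0 (B + 1)"
  proof
    fix y assume y: "y \<in> S'"
    then have "norm y \<le> R' (\<bar>u \<bullet> y\<bar> / norm y)" "u \<bullet> y \<noteq> 0" by (auto simp: S'_def)
    then show "y \<in> ball 0 (B + 1)" using B'[of "\<bar>u \<bullet> y\<bar> / norm y"] q[of y] by auto
  qed
  then have "emeasure lborel S' \<le> emeasure lborel (ball (0::real^5) (B + 1))"
    by (rule emeasure_mono) simp
  then show fin: "emeasure lborel ?S < \<infinity>"
    using emeasure_lborel_ball_finite[of "0::real^5" "B + 1"] unfolding eqS by (simp add: less_le_trans le_less_trans)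
  then have "emeasure lborel S' = ennreal (measure lborel ?S)"
    by (simp add: emeasure_eq_ennreal_measure flip: eqS)
  with vol have "(\<integral>\<^sup>+t. ennreal (rev_const * (R' t ^ 5 * (1 - t\<^sup>2)) * indicator {0<..1} t) \<partial>lborel) = ennreal (measure lborel ?S)"
    by simp
  then have "((\<lambda>t. rev_const * (R' t ^ 5 * (1 - t\<^sup>2)) * indicator {0<..1} t) has_integral measure lborel ?S) UNIV"
    using nn' rev_const_pos by (intro nn_integral_has_integral) (auto simp: indicator_def power_le_one)
  then have "((\<lambda>t. rev_const * (R' t ^ 5 * (1 - t\<^sup>2)) * indicator {0<..1} t / rev_const) has_integral measure lborel ?S / rev_const) UNIV"
    by (rule has_integral_divide)
  also have "(\<lambda>t. rev_const * (R' t ^ 5 * (1 - t\<^sup>2)) * indicator {0<..1} t / rev_const) =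
      (\<lambda>t. if t \<in> {0<..1} then R t ^ 5 * (1 - t\<^sup>2) else 0)"
    using rev_const_pos by (auto simp: R'_def fun_eq_iff)
  finally have "((\<lambda>t. R t ^ 5 * (1 - t\<^sup>2)) has_integral measure lborel ?S / rev_const) {0<..1}"
    by (simp only: has_integral_restrict_UNIV)
  moreover have "negligible {x \<in> {0<..1} - {0..1}. R x ^ 5 * (1 - x\<^sup>2) \<noteq> 0}"
    by (rule negligible_subset[of "{}"]) auto
  moreover have "negligible {x \<in> {0..1} - {0<..1}. R x ^ 5 * (1 - x\<^sup>2) \<noteq> 0}"
    by (rule negligible_subset[of "{0}"]) auto
  ultimately show "((\<lambda>t. R t ^ 5 * (1 - t\<^sup>2)) has_integral measure lborel ?S / rev_const) {0..1}"
    using has_integral_spike_set_eq[of "{0<..1}" "{0..1}" "\<lambda>t. R t ^ 5 * (1 - t\<^sup>2)"] by simp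
qed

section \<open>Third differences\<close>

text \<open>Only two of the three differences are replaced by derivatives, so that monotonicity of
  \<open>g''\<close> decides the sign even where \<open>g''\<close> is not differentiable.
  Derivatives are taken in the open interval because the functions below may fail to have them at 0,
  as the square root does.\<close>

lemma third_difference_mean_value:
  fixes g g' g'' :: "real \<Rightarrow> real"
  assumes "0 < \<delta>" and cont: "continuous_on {0..3 * \<delta>} g"
    and g': "\<And>x. 0 < x \<Longrightarrow> x < 3 * \<delta> \<Longrightarrow> (g has_real_derivative g' x) (at x)"
    and g'': "\<And>x. 0 < x \<Longrightarrow> x < 3 * \<delta> \<Longrightarrow> (g' has_real_derivative g'' x) (at x)"
  obtains \<eta> where "0 < \<eta>" "\<eta> < 2 * \<delta>"
    "g (3 * \<delta>) - 3 * g (2 * \<delta>) + 3 * g \<delta> - g 0 = \<delta>\<^sup>2 * (g'' (\<eta> + \<delta>) - g'' \<eta>)"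
proof -
  \<comment> \<open>\<open>\<phi>\<close> is the second difference of \<open>g\<close>, and
    \<open>dg\<close> is the first difference of \<open>g'\<close>. The mean value theorem is
    applied first to \<open>\<phi>\<close> on \<open>{0..\<delta>}\<close> and then to
    \<open>dg\<close> on an interval of length \<open>\<delta>\<close>.\<close>
  define \<phi> where "\<phi> x = g (x + 2 * \<delta>) - 2 * g (x + \<delta>) + g x" for x
  define dg where "dg x = g' (x + \<delta>) - g' x" for x
  have "continuous_on {0..\<delta>} \<phi>"
    unfolding \<phi>_def using \<open>0 < \<delta>\<close>
    by (intro continuous_intros continuous_on_compose2[OF cont]) auto
  moreover have "(\<phi> has_real_derivative (dg (x + \<delta>) - dg x)) (at x)" if "0 < x" "x < \<delta>" for x
    unfolding \<phi>_def dg_def using that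
    by (auto intro!: derivative_eq_intros DERIV_chain'[OF _ g', of "\<lambda>x. x + _", simplified] g' simp: add.assoc)
  ultimately obtain \<xi> where \<xi>: "0 < \<xi>" "\<xi> < \<delta>" "\<phi> \<delta> - \<phi> 0 = \<delta> * (dg (\<xi> + \<delta>) - dg \<xi>)"
    using MVT[of 0 \<delta> \<phi>] \<open>0 < \<delta>\<close> by (smt (verit, best) DERIV_unique real_differentiable_def)
  have "(dg has_real_derivative (g'' (x + \<delta>) - g'' x)) (at x)" if "0 < x" "x < 2 * \<delta>" for x
    unfolding dg_def using that \<open>0 < \<delta>\<close>
    by (auto intro!: derivative_eq_intros DERIV_chain'[OF _ g'', of "\<lambda>x. x + _", simplified] g'')
  then obtain \<eta> where \<eta>: "\<xi> < \<eta>" "\<eta> < \<xi> + \<delta>" "dg (\<xi> + \<delta>) - dg \<xi> = \<delta> * (g'' (\<eta> + \<delta>) - g'' \<eta>)"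
    using MVT2[of \<xi> "\<xi> + \<delta>" dg "\<lambda>x. g'' (x + \<delta>) - g'' x"] \<open>0 < \<delta>\<close> \<xi> by auto
  show thesis
  proof (rule that)
    show "0 < \<eta>" "\<eta> < 2 * \<delta>" using \<xi> \<eta> by auto
    have "g (3 * \<delta>) - 3 * g (2 * \<delta>) + 3 * g \<delta> - g 0 = \<phi> \<delta> - \<phi> 0"
      by (simp add: \<phi>_def algebra_simps)
    also have "\<dots> = \<delta>\<^sup>2 * (g'' (\<eta> + \<delta>) - g'' \<eta>)"
      unfolding \<xi>(3) \<eta>(3) by (simp add: power2_eq_square)
    finally show "g (3 * \<delta>) - 3 * g (2 * \<delta>) + 3 * g \<delta> - g 0 = \<delta>\<^sup>2 * (g'' (\<eta> + \<delta>) - g'' \<eta>)" .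
  qed
qed

text \<open>At the seam \<open>a\<close> each one-sided difference quotient is that of one branch,
  and both have the limit \<open>f' a\<close>. Each branch has to be differentiable only on its own
  side and at the seam.\<close>

lemma has_real_derivative_If:
  fixes f g :: "real \<Rightarrow> real"
  assumes f: "x \<le> a \<Longrightarrow> (f has_real_derivative f' x) (at x)"
    and g: "a \<le> x \<Longrightarrow> (g has_real_derivative g' x) (at x)"
    and eq: "x = a \<Longrightarrow> f a = g a" "x = a \<Longrightarrow> f' a = g' a"
  shows "((\<lambda>y. if y \<le> a then f y else g y) has_real_derivative (if x \<le> a then f' x else g' x)) (at x)"
proof -
  consider "x < a" | "a < x" | "x = a" by linarith
  then show ?thesis
  proof cases
    case 1
    then have "\<forall>\<^sub>F y in nhds x. y \<in> {..<a}" by (intro eventually_nhds_in_open) auto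
    then have "\<forall>\<^sub>F y in nhds x. (if y \<le> a then f y else g y) = f y" by eventually_elim auto
    then show ?thesis using f 1 by (subst DERIV_cong_ev[OF refl _ refl]) auto
  next
    case 2
    then have "\<forall>\<^sub>F y in nhds x. y \<in> {a<..}" by (intro eventually_nhds_in_open) auto
    then have "\<forall>\<^sub>F y in nhds x. (if y \<le> a then f y else g y) = g y" by eventually_elim auto
    then show ?thesis using g 2 by (subst DERIV_cong_ev[OF refl _ refl]) auto
  next
    case 3
    let ?h = "\<lambda>y. if y \<le> a then f y else g y"
    have "((\<lambda>y. (f y - f a) / (y - a)) \<longlongrightarrow> f' a) (at a)" "((\<lambda>y. (g y - g a) / (y - a)) \<longlongrightarrow> f' a) (at a)"
      using f g eq 3 by (simp_all add: has_field_derivative_iff)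
    then have l: "((\<lambda>y. (f y - f a) / (y - a)) \<longlongrightarrow> f' a) (at_left a)"
      and r: "((\<lambda>y. (g y - g a) / (y - a)) \<longlongrightarrow> f' a) (at_right a)"
      by (auto simp: filterlim_at_split)
    have "((\<lambda>y. (?h y - ?h a) / (y - a)) \<longlongrightarrow> f' a) (at_left a)"
      using eventually_at_left_real[of "a - 1" a]
      by (intro Lim_transform_eventually[OF l]) (auto elim!: eventually_mono)
    moreover have "((\<lambda>y. (?h y - ?h a) / (y - a)) \<longlongrightarrow> f' a) (at_right a)"
      using eventually_at_right_real[of a "a + 1"] eq 3
      by (intro Lim_transform_eventually[OF r]) (auto elim!: eventually_mono)
    ultimately have "((\<lambda>y. (?h y - ?h a) / (y - a)) \<longlongrightarrow> f' a) (at a)"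
      by (simp add: filterlim_at_split)
    then show ?thesis using 3 by (simp add: has_field_derivative_iff)
  qed
qed

text \<open>Up to the factor \<open>rev_const\<close>, this is the integral of \<open>max (d * (\<bar>u \<bullet> y\<bar> / norm y)) b\<close> over the unit
  ball of dimension five, for a unit vector \<open>u\<close>; see \<open>nn_integral_max_ball\<close>.\<close>

definition ballmax :: "real \<Rightarrow> real \<Rightarrow> real" where
  "ballmax d b = (if b \<le> d then d / 4 + b\<^sup>2 / (2 * d) - b ^ 4 / (12 * d ^ 3) else 2 / 3 * b)"

section \<open>Continuity and third differences of the averaged kernel\<close>

lemma ballmax_sqrt_continuous:
  assumes "0 \<le> e"
  shows "continuous_on {0..} (\<lambda>w. ballmax e (sqrt w))"
\<comment> \<open>For \<open>e = 0\<close> the first branch of \<open>ballmax\<close> applies only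
  at \<open>w = 0\<close>, where division by zero makes it 0; the second formula therefore holds for
  all \<open>w\<close> in \<open>{0..}\<close>.\<close>
proof (cases "e = 0")
  case True
  have "continuous_on {0..} (\<lambda>w. 2 / 3 * sqrt w)" by (intro continuous_intros)
  then show ?thesis
    by (rule continuous_on_cong[THEN iffD1, rotated -1, OF _ refl]) (auto simp: ballmax_def True)
next
  case False
  with assms show ?thesis
    unfolding ballmax_def
    by (intro continuous_on_cases_le[where a = e and h = sqrt] continuous_intros)
       (auto simp: field_simps eval_nat_numeral)
qed

text \<open>As a function of \<open>w\<close> the kernel is a quadratic polynomial up to
  \<open>e ^ 2\<close> and a multiple of \<open>sqrt w\<close> beyond. The pieces fit together with
  two derivatives, and the second derivative, constant at first and then
  \<open>- 1 / (6 * sqrt w ^ 3)\<close>, is increasing.\<close>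

lemma ballmax_third_difference_unit:
  assumes e: "0 \<le> e" and "0 < \<delta>"
  shows "0 \<le> ballmax e (sqrt (3 * \<delta>)) - 3 * ballmax e (sqrt (2 * \<delta>)) + 3 * ballmax e (sqrt \<delta>) - ballmax e 0"
proof -
  define F where "F w = (if w \<le> e\<^sup>2 then e / 4 + w / (2 * e) - w\<^sup>2 / (12 * e ^ 3) else 2 / 3 * sqrt w)" for w
  define F' where "F' w = (if w \<le> e\<^sup>2 then 1 / (2 * e) - w / (6 * e ^ 3) else 1 / (3 * sqrt w))" for w
  define F'' where "F'' w = (if w \<le> e\<^sup>2 then - (1 / (6 * e ^ 3)) else - (1 / (6 * sqrt w ^ 3)))" for w
  have F: "ballmax e (sqrt w) = F w" if "0 \<le> w" for w
  proof -
    have "sqrt w \<le> e \<longleftrightarrow> w \<le> e\<^sup>2" using e that by (simp add: real_sqrt_le_iff' real_le_lsqrt sqrt_le_D real_sqrt_le_mono)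
    moreover have "sqrt w ^ 4 = w\<^sup>2" using that power_mult[of "sqrt w" 2 2] by simp
    ultimately show ?thesis using that by (simp add: ballmax_def F_def)
  qed
  have F': "(F has_real_derivative F' w) (at w)" if "0 < w" for w
    unfolding F_def F'_def
  proof (rule has_real_derivative_If)
    assume "w \<le> e\<^sup>2"
    then have "0 < e" using that e by (metis order_le_less power_zero_numeral not_less)
    then show "((\<lambda>w. e / 4 + w / (2 * e) - w\<^sup>2 / (12 * e ^ 3)) has_real_derivative 1 / (2 * e) - w / (6 * e ^ 3)) (at w)"
      by (auto intro!: derivative_eq_intros simp: field_simps eval_nat_numeral)
  next
    show "((\<lambda>w. 2 / 3 * sqrt w) has_real_derivative 1 / (3 * sqrt w)) (at w)"
      using that by (auto intro!: derivative_eq_intros simp: field_simps)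
  next
    assume "w = e\<^sup>2"
    then have "0 < e" using that e by (metis order_le_less power_zero_numeral less_irrefl)
    then show "e / 4 + e\<^sup>2 / (2 * e) - (e\<^sup>2)\<^sup>2 / (12 * e ^ 3) = 2 / 3 * sqrt (e\<^sup>2)"
      "1 / (2 * e) - e\<^sup>2 / (6 * e ^ 3) = 1 / (3 * sqrt (e\<^sup>2))"
      by (auto simp: field_simps eval_nat_numeral)
  qed
  have F'': "(F' has_real_derivative F'' w) (at w)" if "0 < w" for w
    unfolding F'_def F''_def
  proof (rule has_real_derivative_If)
    assume "w \<le> e\<^sup>2"
    then have "0 < e" using that e by (metis order_le_less power_zero_numeral not_less)
    then show "((\<lambda>w. 1 / (2 * e) - w / (6 * e ^ 3)) has_real_derivative - (1 / (6 * e ^ 3))) (at w)"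
      by (auto intro!: derivative_eq_intros simp: field_simps eval_nat_numeral)
  next
    show "((\<lambda>w. 1 / (3 * sqrt w)) has_real_derivative - (1 / (6 * sqrt w ^ 3))) (at w)"
      using that by (auto intro!: derivative_eq_intros simp: field_simps eval_nat_numeral)
  next
    assume "w = e\<^sup>2"
    then have "0 < e" using that e by (metis order_le_less power_zero_numeral less_irrefl)
    then show "1 / (2 * e) - e\<^sup>2 / (6 * e ^ 3) = 1 / (3 * sqrt (e\<^sup>2))"
      "- (1 / (6 * e ^ 3)) = - (1 / (6 * sqrt (e\<^sup>2) ^ 3))"
      by (auto simp: field_simps eval_nat_numeral)
  qed
  have mono: "F'' v \<le> F'' w" if vw: "0 < v" "v \<le> w" for v w
  proof -
    have *: "- (1 / (6 * a ^ 3)) \<le> - (1 / (6 * b ^ 3))" if "0 < a" "a \<le> b" for a b :: real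
      using that by (auto intro!: divide_left_mono power_mono mult_pos_pos)
    show ?thesis
    proof (cases "w \<le> e\<^sup>2")
      case True
      then show ?thesis using vw by (simp add: F''_def)
    next
      case False
      then have "e \<le> sqrt w" by (intro real_le_rsqrt) simp
      moreover have "0 < e" if "v \<le> e\<^sup>2" using e vw that by (metis order_le_less power_zero_numeral not_less)
      ultimately show ?thesis using False vw *[of e "sqrt w"] *[of "sqrt v" "sqrt w"]
        by (auto simp: F''_def)
    qed
  qed
  have "continuous_on {0..3 * \<delta>} (\<lambda>w. ballmax e (sqrt w))"
    by (rule continuous_on_subset[OF ballmax_sqrt_continuous[OF e]]) auto
  then have "continuous_on {0..3 * \<delta>} F" by (rule continuous_on_eq) (simp add: F)
  then obtain \<eta> where "0 < \<eta>" "F (3 * \<delta>) - 3 * F (2 * \<delta>) + 3 * F \<delta> - F 0 = \<delta>\<^sup>2 * (F'' (\<eta> + \<delta>) - F'' \<eta>)"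
    using third_difference_mean_value[OF \<open>0 < \<delta>\<close> _ F' F''] by metis
  moreover have "F'' \<eta> \<le> F'' (\<eta> + \<delta>)" using \<open>0 < \<eta>\<close> \<open>0 < \<delta>\<close> by (intro mono) auto
  ultimately show ?thesis using \<open>0 < \<delta>\<close> F[of 0] by (simp flip: F)
qed

text \<open>\<open>ballmax\<close> is homogeneous of degree one in its two arguments jointly, which
  reduces the claim to \<open>c = 1\<close>. For \<open>c = 0\<close> all four values agree and the
  coefficients 1, -3, 3, -1 add up to 0.\<close>

lemma ballmax_third_difference:
  assumes d: "0 \<le> d" and c: "0 \<le> c" and \<delta>: "0 < \<delta>"
  shows "0 \<le> ballmax d (c * sqrt (3 * \<delta>)) - 3 * ballmax d (c * sqrt (2 * \<delta>))
    + 3 * ballmax d (c * sqrt \<delta>) - ballmax d 0"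
proof (cases "c = 0")
  case False
  then have c: "0 < c" using c by simp
  have *: "ballmax d (c * b) = c * ballmax (d / c) b" if "0 \<le> b" for b
  proof -
    have "c * b \<le> d \<longleftrightarrow> b \<le> d / c" using c by (simp add: field_simps)
    then show ?thesis using c by (auto simp: ballmax_def field_simps eval_nat_numeral)
  qed
  have "0 \<le> c * (ballmax (d / c) (sqrt (3 * \<delta>)) - 3 * ballmax (d / c) (sqrt (2 * \<delta>))
      + 3 * ballmax (d / c) (sqrt \<delta>) - ballmax (d / c) 0)"
    using c d \<delta> by (intro mult_nonneg_nonneg ballmax_third_difference_unit) auto
  then show ?thesis using *[of 0] \<delta> by (simp add: * algebra_simps)
qed simp

section \<open>Averages over the unit ball of dimension five\<close>

text \<open>The sector is the body whose radial function is 1 for cosines from \<open>s\<close> on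
  and 0 below. For this choice \<open>t * R t\<close> is monotone, so the volume formula applies and
  leaves the integral of \<open>1 - t ^ 2\<close> over \<open>{s..1}\<close>.\<close>

lemma emeasure_sector:
  fixes u :: "real^5"
  assumes u: "norm u = 1" and s: "0 \<le> s" "s \<le> 1"
  shows "{y. norm y \<le> 1 \<and> s \<le> \<bar>u \<bullet> y\<bar> / norm y} \<in> sets borel"
    and "emeasure lborel {y. norm y \<le> 1 \<and> s \<le> \<bar>u \<bullet> y\<bar> / norm y} = ennreal (rev_const * (2 / 3 - s + s ^ 3 / 3))"
proof -
  define R :: "real \<Rightarrow> real" where "R t = (if s \<le> t then 1 else 0)" for t
  define S where "S = {y. norm y \<le> R (\<bar>u \<bullet> y\<bar> / norm y)}"
  let ?T = "{y. norm y \<le> 1 \<and> s \<le> \<bar>u \<bullet> y\<bar> / norm y}"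
  have mono: "mono_on {0<..1} (\<lambda>t. t * R t)" by (auto simp: mono_on_def R_def)
  have R1: "R t \<le> 1" "0 \<le> R t" for t by (auto simp: R_def)
  note vol = has_integral_measure_revolution[OF u mono R1, folded S_def]
  show Tm: "?T \<in> sets borel" by measurable
  \<comment> \<open>At \<open>y = 0\<close> the quotient is 0 by convention, and for
    \<open>s > 0\<close> the two sets differ there.\<close>
  have "AE y in lborel. y \<noteq> (0::real^5)" by (rule AE_lborel_singleton)
  then have "AE y in lborel. y \<in> ?T \<longleftrightarrow> y \<in> S"
    by eventually_elim (auto simp: S_def R_def)
  then have "emeasure lborel ?T = emeasure lborel S"
    using vol(1) Tm by (intro emeasure_eq_AE) auto
  also have "\<dots> = ennreal (measure lborel S)" using vol(3) by (simp add: emeasure_eq_ennreal_measure)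
  also have "measure lborel S = rev_const * (2 / 3 - s + s ^ 3 / 3)"
  proof -
    have "((\<lambda>t. 1 - t\<^sup>2) has_integral (1 - 1 ^ 3 / 3) - (s - s ^ 3 / 3)) {s..1}"
      using s by (intro fundamental_theorem_of_calculus)
        (auto intro!: derivative_eq_intros simp flip: has_real_derivative_iff_has_vector_derivative)
    moreover have "(\<lambda>t. R t ^ 5 * (1 - t\<^sup>2)) = (\<lambda>t. if s \<le> t then 1 - t\<^sup>2 else 0)"
      by (auto simp: R_def)
    moreover have "((\<lambda>t. if s \<le> t then 1 - t\<^sup>2 else 0) has_integral x) {0..1} \<longleftrightarrow>
        ((\<lambda>t. 1 - t\<^sup>2) has_integral x) {s..1}" for x
    proof -
      have "((\<lambda>t. if s \<le> t then 1 - t\<^sup>2 else 0) has_integral x) {0..1} \<longleftrightarrow>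
          ((\<lambda>t. if t \<in> {s..1} then 1 - t\<^sup>2 else 0) has_integral x) {0..1}"
        by (intro has_integral_cong) auto
      also have "\<dots> \<longleftrightarrow> ((\<lambda>t. 1 - t\<^sup>2) has_integral x) {s..1}"
        using s by (intro has_integral_restrict) auto
      finally show ?thesis .
    qed
    ultimately have "measure lborel S / rev_const = (1 - 1 ^ 3 / 3) - (s - s ^ 3 / 3)"
      using vol(2) has_integral_unique by metis
    then show ?thesis using rev_const_pos by (simp add: field_simps)
  qed
  finally show "emeasure lborel ?T = ennreal (rev_const * (2 / 3 - s + s ^ 3 / 3))" .
qed

lemma emeasure_unit_ball_rev_const: "emeasure lborel (cball 0 1 :: (real^5) set) = ennreal (rev_const * (2 / 3))"
proof -
  obtain u :: "real^5" where "norm u = 1" using norm_axis_1 by blast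
  moreover have "{y. norm y \<le> 1 \<and> 0 \<le> \<bar>u \<bullet> y\<bar> / norm y} = cball 0 1" by auto
  ultimately show ?thesis using emeasure_sector(2)[of u 0] by simp
qed

lemma sector_polynomial_nonneg:
  fixes x :: real
  assumes "0 \<le> x" "x \<le> 1"
  shows "0 \<le> 2 / 3 - x + x ^ 3 / 3"
proof -
  have "0 \<le> (1 - x)\<^sup>2 * (2 + x)" using assms by simp
  also have "\<dots> = 2 - 3 * x + x ^ 3"
    by (simp add: power2_eq_square power3_eq_cube algebra_simps)
  finally show ?thesis by simp
qed

text \<open>A layer-cake argument: the maximum is \<open>b\<close> plus the length of the interval
  from \<open>b\<close> to \<open>d * q y\<close>. Exchanging integrals leaves \<open>b\<close>
  times the volume of the ball plus the integral over \<open>s\<close> in \<open>{b..d}\<close> of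
  the volumes of the sectors with cosine at least \<open>s / d\<close>.\<close>

lemma nn_integral_max_ball:
  fixes u :: "real^5"
  assumes u: "norm u = 1" and b: "0 \<le> b" and d: "0 \<le> d"
  shows "(\<integral>\<^sup>+y\<in>cball 0 1. ennreal (max (d * (\<bar>u \<bullet> y\<bar> / norm y)) b) \<partial>lborel) = ennreal (rev_const * ballmax d b)"
proof -
  define q where "q y = \<bar>u \<bullet> y\<bar> / norm y" for y :: "real^5"
  have [measurable]: "q \<in> borel_measurable borel" unfolding q_def by measurable
  have q01: "0 \<le> q y" "q y \<le> 1" for y
    using Cauchy_Schwarz_ineq2[of u y] u by (auto simp: q_def divide_le_eq_1)
  let ?B = "cball 0 1 :: (real^5) set"
  have [measurable]: "?B \<in> sets borel" by simp
  have lc: "ennreal (max (d * q y) b) = ennreal b + (\<integral>\<^sup>+s. indicator {b..d} s * indicator {s. s \<le> d * q y} s \<partial>lborel)" for y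
  proof -
    have "d * q y \<le> d" using q01[of y] d by (simp add: mult_left_le)
    then have "(\<integral>\<^sup>+s. indicator {b..d} s * indicator {s. s \<le> d * q y} s \<partial>lborel) = (\<integral>\<^sup>+s. indicator {b..d * q y} s \<partial>lborel)"
      by (intro nn_integral_cong) (auto simp: indicator_def)
    also have "\<dots> = ennreal (max (d * q y) b - b)" by (simp add: max_def emeasure_lborel_Icc_eq)
    finally show ?thesis using b by (simp flip: ennreal_plus)
  qed
  have sec: "(\<integral>\<^sup>+y. indicator ?B y * indicator {s. s \<le> d * q y} s \<partial>lborel) = ennreal (rev_const * (2 / 3 - s / d + (s / d) ^ 3 / 3))"
    if "b \<le> s" "s \<le> d" "0 < d" for s
  proof -
    have "(\<integral>\<^sup>+y. indicator ?B y * indicator {s. s \<le> d * q y} s \<partial>lborel) =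
        (\<integral>\<^sup>+y. indicator {y. norm y \<le> 1 \<and> s / d \<le> \<bar>u \<bullet> y\<bar> / norm y} y \<partial>lborel)"
      using that by (intro nn_integral_cong) (auto simp: indicator_def q_def field_simps)
    also have "\<dots> = ennreal (rev_const * (2 / 3 - s / d + (s / d) ^ 3 / 3))"
      using emeasure_sector[OF u, of "s / d"] that b by (subst nn_integral_indicator) auto
    finally show ?thesis .
  qed
  have "(\<integral>\<^sup>+y\<in>?B. ennreal (max (d * q y) b) \<partial>lborel) =
      (\<integral>\<^sup>+y. ennreal b * indicator ?B y + indicator ?B y * (\<integral>\<^sup>+s. indicator {b..d} s * indicator {s. s \<le> d * q y} s \<partial>lborel) \<partial>lborel)"
    unfolding lc by (intro nn_integral_cong) (simp add: algebra_simps)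
  also have "\<dots> = ennreal b * emeasure lborel ?B +
      (\<integral>\<^sup>+y. indicator ?B y * (\<integral>\<^sup>+s. indicator {b..d} s * indicator {s. s \<le> d * q y} s \<partial>lborel) \<partial>lborel)"
    by (subst nn_integral_add) (auto simp: nn_integral_cmult)
  also have "(\<integral>\<^sup>+y. indicator ?B y * (\<integral>\<^sup>+s. indicator {b..d} s * indicator {s. s \<le> d * q y} s \<partial>lborel) \<partial>lborel) =
      (\<integral>\<^sup>+y. \<integral>\<^sup>+s. indicator ?B y * (indicator {b..d} s * indicator {s. s \<le> d * q y} s) \<partial>lborel \<partial>lborel)"
    by (intro nn_integral_cong nn_integral_cmult[symmetric]) auto
  also have "\<dots> = (\<integral>\<^sup>+s. \<integral>\<^sup>+y. indicator ?B y * (indicator {b..d} s * indicator {s. s \<le> d * q y} s) \<partial>lborel \<partial>lborel)"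
    by (rule lborel_pair.Fubini') measurable
  also have "\<dots> = (\<integral>\<^sup>+s. indicator {b..d} s * (\<integral>\<^sup>+y. indicator ?B y * indicator {s. s \<le> d * q y} s \<partial>lborel) \<partial>lborel)"
    by (intro nn_integral_cong, subst nn_integral_cmult[symmetric]) (auto intro!: nn_integral_cong simp: mult_ac)
  finally have eq: "(\<integral>\<^sup>+y\<in>?B. ennreal (max (d * q y) b) \<partial>lborel) = ennreal b * ennreal (rev_const * (2 / 3)) +
      (\<integral>\<^sup>+s. indicator {b..d} s * (\<integral>\<^sup>+y. indicator ?B y * indicator {s. s \<le> d * q y} s \<partial>lborel) \<partial>lborel)"
    by (simp only: emeasure_unit_ball_rev_const)
  show ?thesis
  proof (cases "b \<le> d \<and> 0 < d")
    \<comment> \<open>Here either \<open>b > d\<close>, so that there are no layers, or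
      \<open>b = d = 0\<close>, so that the layers form a null set.\<close>
    case False
    then have "(\<integral>\<^sup>+s. indicator {b..d} s * (\<integral>\<^sup>+y. indicator ?B y * indicator {s. s \<le> d * q y} s \<partial>lborel) \<partial>lborel) = 0"
    proof (cases "b \<le> d")
      case True
      then have "{b..d} = {0}" using False b d by auto
      moreover have "AE s in lborel. s \<noteq> (0::real)" by (rule AE_lborel_singleton)
      ultimately show ?thesis by (subst nn_integral_0_iff_AE) (auto elim!: eventually_mono)
    qed simp
    moreover have "ballmax d b = 2 / 3 * b" using False b d by (auto simp: ballmax_def)
    ultimately show ?thesis using eq b rev_const_pos by (simp add: q_def mult_ac flip: ennreal_mult)
  next
    case True
    let ?F = "\<lambda>s. rev_const * (2 / 3 * s - s\<^sup>2 / (2 * d) + s ^ 4 / (12 * d ^ 3))"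
    have dF: "(?F has_real_derivative rev_const * (2 / 3 - s / d + (s / d) ^ 3 / 3)) (at s)" for s
      using True by (auto intro!: derivative_eq_intros simp: field_simps eval_nat_numeral)
    have pos: "0 \<le> rev_const * (2 / 3 - s / d + (s / d) ^ 3 / 3)" if "b \<le> s" "s \<le> d" for s
      using rev_const_pos b True that by (intro mult_nonneg_nonneg sector_polynomial_nonneg) auto
    have "(\<integral>\<^sup>+s. indicator {b..d} s * (\<integral>\<^sup>+y. indicator ?B y * indicator {s. s \<le> d * q y} s \<partial>lborel) \<partial>lborel) =
        (\<integral>\<^sup>+s. ennreal (rev_const * (2 / 3 - s / d + (s / d) ^ 3 / 3)) * indicator {b..d} s \<partial>lborel)"
    proof (rule nn_integral_cong)
      fix s
      show "indicator {b..d} s * (\<integral>\<^sup>+y. indicator ?B y * indicator {s. s \<le> d * q y} s \<partial>lborel) =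
          ennreal (rev_const * (2 / 3 - s / d + (s / d) ^ 3 / 3)) * indicator {b..d} s"
        using True sec[of s] by (cases "s \<in> {b..d}") simp_all
    qed
    also have "\<dots> = ?F d - ?F b"
    proof (rule nn_integral_FTC_Icc)
      fix s assume "s \<in> {b..d}"
      then show "(?F has_real_derivative rev_const * (2 / 3 - s / d + (s / d) ^ 3 / 3)) (at s)"
        and "0 \<le> rev_const * (2 / 3 - s / d + (s / d) ^ 3 / 3)"
        using dF pos by auto
    qed (use True in auto)
    finally have "(\<integral>\<^sup>+y\<in>?B. ennreal (max (d * q y) b) \<partial>lborel) = ennreal (b * (rev_const * (2 / 3))) + ennreal (?F d - ?F b)"
      using eq b rev_const_pos by (simp flip: ennreal_mult)
    also have "\<dots> = ennreal (b * (rev_const * (2 / 3)) + (?F d - ?F b))"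
    proof (rule ennreal_plus[symmetric])
      show "0 \<le> b * (rev_const * (2 / 3))" using b rev_const_pos by simp
      have "?F b \<le> ?F d"
      proof (rule DERIV_nonneg_imp_nondecreasing[of b d ?F])
        show "b \<le> d" using True by simp
        fix s assume "b \<le> s" "s \<le> d"
        then show "\<exists>y. (?F has_real_derivative y) (at s) \<and> 0 \<le> y" using dF pos by blast
      qed
      then show "0 \<le> ?F d - ?F b" by simp
    qed
    also have "b * (rev_const * (2 / 3)) + (?F d - ?F b) = rev_const * ballmax d b"
      using True by (simp add: ballmax_def field_simps eval_nat_numeral)
    finally show ?thesis by (simp add: q_def)
  qed
qed

text \<open>The integrand depends on the direction of \<open>y\<close> only, so integrating over the
  ball plays the role of averaging over the unit sphere.\<close>

lemma nn_integral_abs_ball: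
  fixes w :: "real^5"
  shows "(\<integral>\<^sup>+y\<in>cball 0 1. ennreal \<bar>w \<bullet> (y /\<^sub>R norm y) + b\<bar> \<partial>lborel) = ennreal (rev_const * ballmax (norm w) \<bar>b\<bar>)"
proof -
  obtain u where u: "norm u = 1" "w = norm w *\<^sub>R u"
  proof (cases "w = 0")
    case True
    obtain u :: "real^5" where "norm u = 1" using norm_axis_1 by blast
    then show thesis using that[of u] True by simp
  next
    case False
    then show thesis using that[of "w /\<^sub>R norm w"] by simp
  qed
  define f where "f y = ennreal \<bar>w \<bullet> (y /\<^sub>R norm y) + b\<bar> * indicator (cball 0 1) y" for y :: "real^5"
  have [measurable]: "cball (0::real^5) 1 \<in> sets borel" by simp
  have fm: "f \<in> borel_measurable borel" unfolding f_def by measurable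
  \<comment> \<open>Averaging over \<open>y\<close> and \<open>- y\<close> replaces \<open>\<bar>x + b\<bar>\<close> by \<open>max \<bar>x\<bar> \<bar>b\<bar>\<close>.\<close>
  have "(\<integral>\<^sup>+y. f y \<partial>lborel) = (\<integral>\<^sup>+y. f y \<partial>distr lborel borel uminus)"
    by (simp add: distr_lborel_orthogonal_transformation orthogonal_transformation_def linear_iff)
  also have "\<dots> = (\<integral>\<^sup>+y. f (- y) \<partial>lborel)"
    using fm by (intro nn_integral_distr) auto
  finally have "2 * (\<integral>\<^sup>+y. f y \<partial>lborel) = (\<integral>\<^sup>+y. f y + f (- y) \<partial>lborel)"
    using fm by (subst nn_integral_add) (auto simp: mult_2)
  also have "\<dots> = (\<integral>\<^sup>+y. 2 * (ennreal (max (norm w * (\<bar>u \<bullet> y\<bar> / norm y)) \<bar>b\<bar>) * indicator (cball 0 1) y) \<partial>lborel)"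
  proof (rule nn_integral_cong)
    fix y :: "real^5"
    define x where "x = w \<bullet> (y /\<^sub>R norm y)"
    have "\<bar>x\<bar> = norm w * (\<bar>u \<bullet> y\<bar> / norm y)"
      unfolding x_def by (subst u(2)) (simp add: abs_mult field_simps)
    moreover have "\<bar>x + b\<bar> + \<bar>- x + b\<bar> = 2 * max \<bar>x\<bar> \<bar>b\<bar>" by (auto simp: max_def abs_if)
    then have "ennreal \<bar>x + b\<bar> + ennreal \<bar>- x + b\<bar> = 2 * ennreal (max \<bar>x\<bar> \<bar>b\<bar>)"
      by (simp add: ennreal_mult flip: ennreal_plus)
    moreover have "f y + f (- y) = (ennreal \<bar>x + b\<bar> + ennreal \<bar>- x + b\<bar>) * indicator (cball 0 1) y"
      by (simp add: f_def x_def indicator_def)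
    ultimately show "f y + f (- y) = 2 * (ennreal (max (norm w * (\<bar>u \<bullet> y\<bar> / norm y)) \<bar>b\<bar>) * indicator (cball 0 1) y)"
      by (simp add: mult.assoc)
  qed
  also have "\<dots> = 2 * (\<integral>\<^sup>+y. ennreal (max (norm w * (\<bar>u \<bullet> y\<bar> / norm y)) \<bar>b\<bar>) * indicator (cball 0 1) y \<partial>lborel)"
    by (rule nn_integral_cmult) measurable
  also have "\<dots> = 2 * ennreal (rev_const * ballmax (norm w) \<bar>b\<bar>)"
    by (subst nn_integral_max_ball[OF u(1)]) auto
  finally show ?thesis by (simp add: f_def ennreal_mult_cancel_left)
qed

section \<open>Central sections of bodies of revolution\<close>

text \<open>If \<open>K\<close> contains the ball around \<open>x\<close>, a small vector
  \<open>y\<close> is the midpoint of \<open>x + y\<close> and \<open>- (x - y)\<close>, both of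
  which lie in \<open>K\<close>.\<close>

lemma convex_body_zero_interior:
  fixes K :: "'a::euclidean_space set"
  assumes "convex_body K" "origin_symmetric K"
  obtains \<epsilon> where "0 < \<epsilon>" "cball 0 \<epsilon> \<subseteq> K"
proof -
  obtain x e where "0 < e" and xe: "cball x e \<subseteq> K"
    using assms(1) by (auto simp: convex_body_def mem_interior_cball)
  have "cball 0 e \<subseteq> K"
  proof
    fix y :: 'a assume y: "y \<in> cball 0 e"
    have "x + y \<in> K" "x - y \<in> K" using y xe by (auto simp: dist_norm subset_iff)
    then have "y - x \<in> K" using assms(2) by (force simp: origin_symmetric_def)
    then have "(1 / 2) *\<^sub>R (x + y) + (1 / 2) *\<^sub>R (y - x) \<in> K"
      using \<open>x + y \<in> K\<close> assms(1) by (intro convexD) (auto simp: convex_body_def)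
    moreover have "(1 / 2) *\<^sub>R (x + y) + (1 / 2) *\<^sub>R (y - x) = y"
      by (simp flip: scaleR_add_right)
    ultimately show "y \<in> K" by simp
  qed
  then show thesis using that \<open>0 < e\<close> by blast
qed

text \<open>For \<open>r\<close> the fifth power of the profile this is, up to the factor
  \<open>rev_const * sqrt p\<close>, the volume of a central section whose normal has squared cosine
  \<open>1 - 1 / p\<close> with the axis. The upper limit \<open>1 / sqrt p\<close> is the largest
  cosine with the axis that occurs in that hyperplane.\<close>

definition section_integral :: "(real \<Rightarrow> real) \<Rightarrow> real \<Rightarrow> real" where
  "section_integral r p = integral {0..1 / sqrt p} (\<lambda>t. r t * (1 - p * t\<^sup>2))"

lemma mem_iff_norm_le_radial_function:
  fixes K :: "'a::euclidean_space set"
  assumes "compact K" "convex K" "0 \<in> K" "norm \<xi> = 1" "0 \<le> l"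
  shows "l *\<^sub>R \<xi> \<in> K \<longleftrightarrow> l \<le> radial_function K \<xi>"
proof
  have "\<xi> \<noteq> 0" using assms(4) by auto
  note rad = radial_function_attained[OF assms(1,3) this]
  show "l *\<^sub>R \<xi> \<in> K \<Longrightarrow> l \<le> radial_function K \<xi>" using rad(3) assms(5) by blast
  assume l: "l \<le> radial_function K \<xi>"
  show "l *\<^sub>R \<xi> \<in> K"
  proof (cases "l = 0")
    case False
    then have "0 < radial_function K \<xi>" using l assms(5) by linarith
    then have "(l / radial_function K \<xi>) *\<^sub>R (radial_function K \<xi> *\<^sub>R \<xi>) + (1 - l / radial_function K \<xi>) *\<^sub>R 0 \<in> K"
      using rad(2) assms l by (intro convexD) auto
    then show ?thesis using \<open>0 < radial_function K \<xi>\<close> by simp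
  qed (use assms in simp)
qed

lemma scaleR_convex_combination:
  fixes x z :: "'a::real_vector"
  shows "l *\<^sub>R (a *\<^sub>R x + z) + (1 - l) *\<^sub>R (b *\<^sub>R x + z) = (l * a + (1 - l) * b) *\<^sub>R x + z"
  by (simp add: algebra_simps)

lemma norm_meridian_point:
  assumes "\<bar>t\<bar> \<le> 1"
  shows "norm (sqrt (1 - t\<^sup>2) *\<^sub>R axis 1 1 + t *\<^sub>R e6 :: real^6) = 1" (is "norm ?v = 1")
proof -
  have "?v \<bullet> ?v = 1"
    using assms by (simp add: inner_add_left inner_add_right inner_axis_axis abs_square_le_1 flip: power2_eq_square)
  then show ?thesis by (simp add: norm_eq_sqrt_inner)
qed

section \<open>Profile and central sections of a fixed body of revolution\<close>

context
  fixes K :: "(real^6) set"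
  assumes K: "convex_body K" "origin_symmetric K" "body_of_revolution K"
begin

lemma body_facts: "compact K" "convex K" "0 \<in> K" "- x \<in> K \<longleftrightarrow> x \<in> K"
proof -
  show "compact K" "convex K" using K(1) by (auto simp: convex_body_def)
  obtain \<epsilon> where "0 < \<epsilon>" "cball 0 \<epsilon> \<subseteq> K" using convex_body_zero_interior[OF K(1,2)] by blast
  then show "0 \<in> K" by auto
  show "- x \<in> K \<longleftrightarrow> x \<in> K" using K(2) by (metis minus_minus origin_symmetric_def)
qed

text \<open>Rotation about the axis moves \<open>x\<close> to the reference meridian, and the
  symmetry of \<open>K\<close> about the origin allows the cosine to be replaced by its absolute
  value.\<close>

lemma mem_iff_profile:
  assumes x: "x \<noteq> 0"
  shows "x \<in> K \<longleftrightarrow> norm x \<le> radial_profile K (\<bar>x $ 6\<bar> / norm x)"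
proof -
  have *: "x \<in> K \<longleftrightarrow> norm x \<le> radial_profile K (x $ 6 / norm x)" if x: "x \<noteq> 0" for x
  proof -
    define t where "t = x $ 6 / norm x"
    define y where "y = x - (x $ 6) *\<^sub>R e6"
    have y6: "y $ 6 = 0" by (simp add: y_def)
    have orth: "y \<bullet> e6 = 0" by (simp add: inner_axis y6)
    have t1: "\<bar>t\<bar> \<le> 1" using component_le_norm_cart[of x 6] x by (simp add: t_def)
    have "(norm x)\<^sup>2 = (norm (y + (x $ 6) *\<^sub>R e6))\<^sup>2" by (simp add: y_def)
    also have "\<dots> = (norm y)\<^sup>2 + (x $ 6)\<^sup>2"
      using orth by (subst norm_add_Pythagorean) (auto simp: orthogonal_def)
    finally have "(norm x)\<^sup>2 = (norm y)\<^sup>2 + (x $ 6)\<^sup>2" .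
    moreover have "x $ 6 = norm x * t" using x by (simp add: t_def)
    ultimately have ny2: "(norm y)\<^sup>2 = (norm x)\<^sup>2 * (1 - t\<^sup>2)"
      by (simp add: power_mult_distrib algebra_simps)
    have ny: "norm y = norm x * sqrt (1 - t\<^sup>2)"
      using arg_cong[OF ny2, of sqrt] by (simp add: real_sqrt_mult)
    obtain \<eta> :: "real^6" where \<eta>: "norm \<eta> = 1" "\<eta> $ 6 = 0" "y = norm y *\<^sub>R \<eta>"
    proof (cases "y = 0")
      case True
      have "(axis 1 1 :: real^6) $ 6 = 0" by (simp add: axis_def)
      then show thesis using that[of "axis 1 1"] True by simp
    next
      case False
      then show thesis using that[of "y /\<^sub>R norm y"] y6 by simp
    qed
    define \<xi> where "\<xi> = sqrt (1 - t\<^sup>2) *\<^sub>R \<eta> + t *\<^sub>R e6"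
    have "x = y + (x $ 6) *\<^sub>R e6" by (simp add: y_def)
    also have "\<dots> = norm x *\<^sub>R \<xi>"
      using x by (subst \<eta>(3)) (simp add: \<xi>_def ny scaleR_add_right t_def)
    finally have x\<xi>: "x = norm x *\<^sub>R \<xi>" .
    then have "norm \<xi> = 1" using x by (metis norm_scaleR abs_norm_cancel mult_cancel_left1 norm_eq_zero)
    then have "x \<in> K \<longleftrightarrow> norm x \<le> radial_function K \<xi>"
      using mem_iff_norm_le_radial_function[OF body_facts(1-3), of \<xi> "norm x"] x\<xi> by simp
    then show ?thesis
      using radial_profile_eq[OF K(3) \<eta>(1,2)] by (simp add: \<xi>_def t_def)
  qed
  show ?thesis
  proof (cases "0 \<le> x $ 6")
    case True
    then show ?thesis using *[OF x] by simp
  next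
    case False
    then show ?thesis using *[of "- x"] x body_facts(4)[of x] by simp
  qed
qed

lemma mem_depends_on_norms:
  assumes "norm x = norm y" "\<bar>x $ 6\<bar> = \<bar>y $ 6\<bar>"
  shows "x \<in> K \<longleftrightarrow> y \<in> K"
proof (cases "x = 0")
  case True
  then show ?thesis using assms(1) by simp
next
  case False
  moreover have "y \<noteq> 0" using False assms(1) by auto
  ultimately show ?thesis using mem_iff_profile[of x] mem_iff_profile[of y] assms by simp
qed

lemma profile_mem:
  assumes t: "\<bar>t\<bar> \<le> 1" and l: "0 \<le> l"
  shows "l *\<^sub>R (sqrt (1 - t\<^sup>2) *\<^sub>R axis 1 1 + t *\<^sub>R e6) \<in> K \<longleftrightarrow> l \<le> radial_profile K t"
  unfolding radial_profile_def
  using mem_iff_norm_le_radial_function[OF body_facts(1-3) norm_meridian_point[OF t] l] .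

lemma profile_bounds:
  obtains \<epsilon> B where "0 < \<epsilon>" "\<And>t. \<bar>t\<bar> \<le> 1 \<Longrightarrow> \<epsilon> \<le> radial_profile K t" "\<And>t. \<bar>t\<bar> \<le> 1 \<Longrightarrow> radial_profile K t \<le> B"
proof -
  obtain \<epsilon> where \<epsilon>: "0 < \<epsilon>" "cball 0 \<epsilon> \<subseteq> K" using convex_body_zero_interior[OF K(1,2)] by blast
  obtain B where B: "\<And>x. x \<in> K \<Longrightarrow> norm x \<le> B"
    using compact_imp_bounded[OF body_facts(1)] unfolding bounded_iff by blast
  show thesis
  proof (rule that[OF \<epsilon>(1)])
    fix t :: real assume t: "\<bar>t\<bar> \<le> 1"
    let ?v = "sqrt (1 - t\<^sup>2) *\<^sub>R axis 1 1 + t *\<^sub>R e6 :: real^6"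
    have v: "norm ?v = 1" by (rule norm_meridian_point[OF t])
    have "\<epsilon> *\<^sub>R ?v \<in> cball 0 \<epsilon>" using v \<epsilon>(1) by simp
    then have "\<epsilon> *\<^sub>R ?v \<in> K" using \<epsilon>(2) by blast
    then show ge: "\<epsilon> \<le> radial_profile K t" using profile_mem[OF t, of \<epsilon>] \<epsilon>(1) by simp
    then have "radial_profile K t *\<^sub>R ?v \<in> K" using profile_mem[OF t, of "radial_profile K t"] \<epsilon>(1) by simp
    then show "radial_profile K t \<le> B" using B[of "radial_profile K t *\<^sub>R ?v"] v ge \<epsilon>(1) by simp
  qed
qed

text \<open>Convexity in the form of a horizontal chord: the boundary point with cosine
  \<open>s\<close> and its mirror image span a segment of height \<open>s * \<rho>\<close>. This
  segment contains the point of the same height with cosine \<open>t >= s\<close>, whose norm is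
  \<open>s * \<rho> / t\<close>.\<close>

lemma profile_mono: "mono_on {0<..1} (\<lambda>t. t * radial_profile K t)"
proof (rule mono_onI)
  fix s t :: real assume st: "s \<in> {0<..1}" "t \<in> {0<..1}" "s \<le> t"
  obtain \<epsilon> B where \<epsilon>: "0 < \<epsilon>" "\<And>t. \<bar>t\<bar> \<le> 1 \<Longrightarrow> \<epsilon> \<le> radial_profile K t" using profile_bounds by metis
  define \<rho> where "\<rho> = radial_profile K s"
  have \<rho>: "0 < \<rho>" using \<epsilon>(1) \<epsilon>(2)[of s] st by (auto simp: \<rho>_def)
  \<comment> \<open>\<open>c\<close> and \<open>b\<close> are the distances from the axis of the
    points with cosines \<open>s\<close> and \<open>t\<close> at the common height
    \<open>s * \<rho>\<close>.\<close>
  define c where "c = \<rho> * sqrt (1 - s\<^sup>2)"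
  define b where "b = s * \<rho> / t * sqrt (1 - t\<^sup>2)"
  have c0: "0 \<le> c" using \<rho> st by (auto simp: c_def power_le_one)
  have b0: "0 \<le> b" using \<rho> st by (auto simp: b_def power_le_one)
  have "b\<^sup>2 \<le> c\<^sup>2"
  proof -
    have "b\<^sup>2 = \<rho>\<^sup>2 * ((s / t)\<^sup>2 * (1 - t\<^sup>2))"
      using st by (simp add: b_def power_mult_distrib power_divide power_le_one)
    also have "(s / t)\<^sup>2 * (1 - t\<^sup>2) = (s / t)\<^sup>2 - s\<^sup>2" using st by (simp add: field_simps)
    also have "\<dots> \<le> 1 - s\<^sup>2" using st by (simp add: power_le_one)
    also have "\<rho>\<^sup>2 * (1 - s\<^sup>2) = c\<^sup>2" using st by (simp add: c_def power_mult_distrib power_le_one)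
    finally show ?thesis by (simp add: mult_left_mono)
  qed
  then have bc: "b \<le> c" using c0 by (rule power2_le_imp_le)
  define P where "P w = w *\<^sub>R axis 1 1 + (s * \<rho>) *\<^sub>R e6" for w :: real
  have "P c = \<rho> *\<^sub>R (sqrt (1 - s\<^sup>2) *\<^sub>R axis 1 1 + s *\<^sub>R e6)"
    by (simp add: P_def c_def scaleR_add_right mult.commute)
  then have Pc: "P c \<in> K" using profile_mem[of s \<rho>] st \<rho> by (simp add: \<rho>_def)
  have nP: "(norm (P w))\<^sup>2 = w\<^sup>2 + (s * \<rho>)\<^sup>2" for w
    by (simp add: P_def power2_norm_eq_inner inner_add_left inner_add_right inner_axis_axis flip: power2_eq_square)
  have "norm (P (- c)) = norm (P c)" by (rule power2_eq_imp_eq) (auto simp: nP)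
  moreover have "P w $ 6 = s * \<rho>" for w by (simp add: P_def axis_def)
  ultimately have Pc': "P (- c) \<in> K" using mem_depends_on_norms[of "P (- c)" "P c"] Pc by simp
  have "P b \<in> K"
  proof (cases "c = 0")
    case True
    then show ?thesis using Pc b0 bc by simp
  next
    case False
    \<comment> \<open>The weight for which \<open>lam * c + (1 - lam) * (- c)\<close> equals
      \<open>b\<close>.\<close>
    define lam where "lam = (1 + b / c) / 2"
    have l: "0 \<le> lam" "0 \<le> 1 - lam" using False b0 c0 bc by (auto simp: lam_def field_simps)
    have "lam *\<^sub>R P c + (1 - lam) *\<^sub>R P (- c) \<in> K"
      using body_facts(2) Pc Pc' l by (intro convexD) auto
    moreover have "lam *\<^sub>R P c + (1 - lam) *\<^sub>R P (- c) = P b"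
    proof -
      have "lam *\<^sub>R P c + (1 - lam) *\<^sub>R P (- c) = (lam * c + (1 - lam) * - c) *\<^sub>R axis 1 1 + (s * \<rho>) *\<^sub>R e6"
        unfolding P_def by (rule scaleR_convex_combination)
      also have "lam * c + (1 - lam) * - c = b" using False by (simp add: lam_def field_simps)
      finally show ?thesis by (simp add: P_def)
    qed
    ultimately show ?thesis by simp
  qed
  moreover have "P b = (s * \<rho> / t) *\<^sub>R (sqrt (1 - t\<^sup>2) *\<^sub>R axis 1 1 + t *\<^sub>R e6)"
    using st by (simp add: P_def b_def scaleR_add_right)
  ultimately have "s * \<rho> / t \<le> radial_profile K t"
    using profile_mem[of t "s * \<rho> / t"] st \<rho> by simp
  then show "s * radial_profile K s \<le> t * radial_profile K t"
    using st by (simp add: \<rho>_def field_simps)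
qed

lemma integrable_profile_power5: "(\<lambda>t. radial_profile K t ^ 5) integrable_on {0..1}"
proof -
  obtain \<epsilon> B where \<epsilon>: "0 < \<epsilon>" "\<And>t. \<bar>t\<bar> \<le> 1 \<Longrightarrow> \<epsilon> \<le> radial_profile K t" "\<And>t. \<bar>t\<bar> \<le> 1 \<Longrightarrow> radial_profile K t \<le> B"
    using profile_bounds by metis
  define R where "R t = (if t \<in> {0<..1} then radial_profile K t else 0)" for t
  have [measurable]: "R \<in> borel_measurable borel"
    unfolding R_def[abs_def] by (rule borel_measurable_if_mono_times_id[OF profile_mono])
  have "integrable lborel (\<lambda>t. R t ^ 5)"
  proof (rule integrableI_bounded_set)
    show "{0<..1::real} \<in> sets lborel" "(\<lambda>t. R t ^ 5) \<in> borel_measurable lborel" by measurable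
    show "emeasure lborel {0<..1::real} < \<infinity>" by simp
    show "AE t in lborel. t \<in> {0<..1} \<longrightarrow> norm (R t ^ 5) \<le> B ^ 5"
    proof (intro AE_I2 impI)
      fix t :: real assume "t \<in> {0<..1}"
      then show "norm (R t ^ 5) \<le> B ^ 5"
        using \<epsilon>(1) \<epsilon>(2)[of t] \<epsilon>(3)[of t] by (auto simp: R_def intro!: power_mono)
    qed
    show "AE t in lborel. t \<notin> {0<..1} \<longrightarrow> R t ^ 5 = 0"
      by (intro AE_I2) (auto simp: R_def)
  qed
  then have "(\<lambda>t. R t ^ 5) integrable_on UNIV" by (rule integrable_on_lborel)
  then have "(\<lambda>t. R t ^ 5) integrable_on {0..1}" by (rule integrable_on_subinterval) simp
  moreover have "radial_profile K t ^ 5 = R t ^ 5" if "t \<in> {0..1} - {0}" for t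
    using that by (auto simp: R_def)
  ultimately show ?thesis by (metis integrable_spike_finite finite.emptyI finite.insertI)
qed

text \<open>The section is itself a body of revolution, now in dimension five, with profile
  \<open>radial_profile K (q * \<tau>)\<close>, where \<open>q = 1 / sqrt p\<close> is the length of
  the projection of the axis vector to the hyperplane. Positivity comes from the lower bound on the
  profile.\<close>

lemma hyperplane_volume_section:
  assumes p: "1 \<le> p" and \<xi>: "norm \<xi> = 1" "(\<xi> $ 6)\<^sup>2 = 1 - 1 / p"
  shows "hyperplane_volume \<xi> (K \<inter> orth_complement \<xi>) = rev_const * sqrt p * section_integral (\<lambda>t. radial_profile K t ^ 5) p"
    and "0 < section_integral (\<lambda>t. radial_profile K t ^ 5) p"
proof -
  obtain \<epsilon> B where \<epsilon>: "0 < \<epsilon>" "\<And>t. \<bar>t\<bar> \<le> 1 \<Longrightarrow> \<epsilon> \<le> radial_profile K t" "\<And>t. \<bar>t\<bar> \<le> 1 \<Longrightarrow> radial_profile K t \<le> B"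
    using profile_bounds by metis
  define q where "q = 1 / sqrt p"
  have q: "0 < q" "q \<le> 1" using p by (auto simp: q_def)
  have "\<xi> \<noteq> 0" using \<xi>(1) by auto
  then obtain f where iso: "hyperplane_isometry \<xi> f" using hyperplane_isometry_exists by blast
  then have f: "linear f" "\<And>x. norm (f x) = norm x" "range f = orth_complement \<xi>"
    by (auto simp: hyperplane_isometry_def)
  have orth: "\<xi> \<bullet> f y = 0" for y using f(3) by (force simp: orth_complement_def)
  note inn = linear_isometry_inner[OF f(1,2)]
  have \<xi>\<xi>: "\<xi> \<bullet> \<xi> = 1" using \<xi>(1) by (simp add: norm_eq_1)
  have \<xi>6: "\<xi> \<bullet> e6 = \<xi> $ 6" by (simp add: inner_axis)
  \<comment> \<open>The projection of the axis vector to the hyperplane; its normalized preimage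
    \<open>u\<close> is the axis of the section.\<close>
  have "e6 - (\<xi> $ 6) *\<^sub>R \<xi> \<in> range f"
    unfolding f(3) orth_complement_def using \<xi>\<xi> \<xi>6 by (simp add: inner_diff_right)
  then obtain w where w: "f w = e6 - (\<xi> $ 6) *\<^sub>R \<xi>" by (metis imageE)
  have "w \<bullet> w = (e6 - (\<xi> $ 6) *\<^sub>R \<xi>) \<bullet> (e6 - (\<xi> $ 6) *\<^sub>R \<xi>)" unfolding w[symmetric] inn ..
  also have "\<dots> = 1 - (\<xi> $ 6)\<^sup>2"
    using \<xi>\<xi> \<xi>6 by (simp add: inner_diff_left inner_diff_right inner_commute[of e6 \<xi>] power2_eq_square inner_axis_axis)
  also have "\<dots> = q\<^sup>2" using \<xi>(2) p by (simp add: q_def power_divide)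
  finally have nw: "norm w = q" using q by (simp add: norm_eq_sqrt_inner)
  define u where "u = w /\<^sub>R q"
  have u: "norm u = 1" using nw q by (simp add: u_def)
  have f6: "f y $ 6 = q * (u \<bullet> y)" for y
  proof -
    have "f y $ 6 = e6 \<bullet> f y" by (simp add: inner_axis')
    also have "\<dots> = f w \<bullet> f y" by (simp add: w inner_diff_left orth)
    also have "\<dots> = q * (u \<bullet> y)" using q by (simp add: inn u_def)
    finally show ?thesis .
  qed
  define R where "R \<tau> = radial_profile K (q * \<tau>)" for \<tau>
  have q\<tau>: "\<bar>q * \<tau>\<bar> \<le> 1" if "0 \<le> \<tau>" "\<tau> \<le> 1" for \<tau>
    using mult_le_one[of q \<tau>] q that by (simp add: abs_mult)
  have mono: "mono_on {0<..1} (\<lambda>\<tau>. \<tau> * R \<tau>)"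
  proof (rule mono_onI)
    fix s t :: real assume st: "s \<in> {0<..1}" "t \<in> {0<..1}" "s \<le> t"
    then have "(q * s) * radial_profile K (q * s) \<le> (q * t) * radial_profile K (q * t)"
      using q q\<tau>[of s] q\<tau>[of t] by (intro mono_onD[OF profile_mono]) auto
    then show "s * R s \<le> t * R t" using q by (simp add: R_def mult.assoc)
  qed
  have RB: "R \<tau> \<le> B" "0 \<le> R \<tau>" "\<epsilon> \<le> R \<tau>" if "0 \<le> \<tau>" "\<tau> \<le> 1" for \<tau>
    using \<epsilon>(1) \<epsilon>(2)[OF q\<tau>[OF that]] \<epsilon>(3)[OF q\<tau>[OF that]] by (auto simp: R_def)
  define S where "S = {y. norm y \<le> R (\<bar>u \<bullet> y\<bar> / norm y)}"
  have "f -` (K \<inter> orth_complement \<xi>) = S"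
  proof (rule set_eqI)
    fix y
    show "y \<in> f -` (K \<inter> orth_complement \<xi>) \<longleftrightarrow> y \<in> S"
    proof (cases "y = 0")
      case True
      then show ?thesis using RB[of 0] body_facts(3) linear_0[OF f(1)]
        by (simp add: S_def orth_complement_def)
    next
      case False
      then have "f y \<noteq> 0" using f(2)[of y] by auto
      then show ?thesis using mem_iff_profile[of "f y"] orth[of y] q
        by (simp add: S_def R_def orth_complement_def f(2) f6 abs_mult)
    qed
  qed
  moreover have "compact (K \<inter> orth_complement \<xi>)"
    unfolding orth_complement_def using body_facts(1) closed_hyperplane by (intro compact_Int_closed)
  ultimately have V: "hyperplane_volume \<xi> (K \<inter> orth_complement \<xi>) = measure lebesgue S"
    using hyperplane_volume_eq[OF iso] by simp
  note vol = has_integral_measure_revolution[OF u mono RB(1,2), folded S_def]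
  have V': "measure lebesgue S = measure lborel S" using vol(1) by simp
  define i where "i = measure lborel S / rev_const"
  have i: "((\<lambda>t. R t ^ 5 * (1 - t\<^sup>2)) has_integral i) {0..1}" using vol(2) by (simp add: i_def)
  have sp: "0 < sqrt p" using p by simp
  \<comment> \<open>Rescaling the cosine within the hyperplane to the cosine with the original
    axis.\<close>
  have "((\<lambda>t. R (sqrt p * t) ^ 5 * (1 - (sqrt p * t)\<^sup>2)) has_integral (1 / \<bar>sqrt p\<bar>) * i) ((\<lambda>x. x / sqrt p) ` {0..1})"
    using has_integral_stretch_real[OF i, of "sqrt p"] sp by simp
  moreover have "(\<lambda>t. R (sqrt p * t) ^ 5 * (1 - (sqrt p * t)\<^sup>2)) = (\<lambda>t. radial_profile K t ^ 5 * (1 - p * t\<^sup>2))"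
    using p sp by (simp add: R_def q_def power_mult_distrib)
  moreover have "(\<lambda>x. x / sqrt p) ` {0..1} = {0..1 / sqrt p}"
    using sp by (simp add: image_divide_atLeastAtMost)
  ultimately have sec: "section_integral (\<lambda>t. radial_profile K t ^ 5) p = i / sqrt p"
    unfolding section_integral_def using sp by (intro integral_unique) simp
  show "hyperplane_volume \<xi> (K \<inter> orth_complement \<xi>) = rev_const * sqrt p * section_integral (\<lambda>t. radial_profile K t ^ 5) p"
    unfolding V V' sec using sp rev_const_pos by (simp add: i_def)
  have "((\<lambda>t::real. 1 - t\<^sup>2) has_integral (1 - 1 ^ 3 / 3) - (0 - 0 ^ 3 / 3)) {0..1}"
    by (intro fundamental_theorem_of_calculus)
      (auto intro!: derivative_eq_intros simp flip: has_real_derivative_iff_has_vector_derivative)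
  then have "((\<lambda>t::real. \<epsilon> ^ 5 * (1 - t\<^sup>2)) has_integral \<epsilon> ^ 5 * ((1 - 1 ^ 3 / 3) - (0 - 0 ^ 3 / 3))) {0..1}"
    by (rule has_integral_mult_right)
  then have "\<epsilon> ^ 5 * ((1 - 1 ^ 3 / 3) - (0 - 0 ^ 3 / 3)) \<le> i"
    using i
  proof (rule has_integral_le)
    fix t :: real assume "t \<in> {0..1}"
    then have "0 \<le> t" "t \<le> 1" by auto
    then have "\<epsilon> ^ 5 \<le> R t ^ 5" "0 \<le> 1 - t\<^sup>2"
      using RB(3)[of t] \<epsilon>(1) by (auto intro: power_mono simp: power_le_one)
    then show "\<epsilon> ^ 5 * (1 - t\<^sup>2) \<le> R t ^ 5 * (1 - t\<^sup>2)" by (rule mult_right_mono)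
  qed
  then have "\<epsilon> ^ 5 * (2 / 3) \<le> i" by simp
  moreover have "0 < \<epsilon> ^ 5 * (2 / 3)" using \<epsilon>(1) by simp
  ultimately have "0 < i" by linarith
  then show "0 < section_integral (\<lambda>t. radial_profile K t ^ 5) p" unfolding sec using sp by simp
qed

end

section \<open>The third derivative of the reciprocal section integral\<close>

text \<open>The third derivative of the reciprocal is computed for \<open>p\<close> slightly above
  1, where \<open>r\<close> is differentiable at \<open>1 / sqrt p\<close>. Its right-hand limit at
  1 is negative by \<open>neg\<close>, so the second derivative decreases near 1, and the mean value
  form of the third difference gives the sign.\<close>

lemma third_difference_inverse_section_integral:
  fixes r r' :: "real \<Rightarrow> real"
  assumes a: "0 < a" "a < 1" and int: "r integrable_on {0..1}"
    and dr: "\<And>t. a < t \<Longrightarrow> t \<le> 1 \<Longrightarrow> (r has_real_derivative r' t) (at t within {a<..1})"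
    and cr': "(r' \<longlongrightarrow> r' 1) (at 1 within {a<..1})"
    and pos: "\<And>p. 1 \<le> p \<Longrightarrow> 0 < section_integral r p"
    and k: "k = integral {0..1} (\<lambda>t. t\<^sup>2 * r t)"
    and neg: "(section_integral r 1)\<^sup>2 * (5 * r 1 + r' 1) + 24 * k ^ 3 < 12 * section_integral r 1 * k * r 1"
  obtains \<delta> where "0 < \<delta>"
    "1 / section_integral r (1 + 3 * \<delta>) - 3 * (1 / section_integral r (1 + 2 * \<delta>))
      + 3 * (1 / section_integral r (1 + \<delta>)) - 1 / section_integral r 1 < 0"
proof -
  let ?H = "section_integral r"
  define s where "s p = 1 / sqrt p" for p :: real
  have s01: "0 < s p" "s p \<le> 1" if "1 \<le> p" for p using that by (auto simp: s_def)
  have s1: "s 1 = 1" by (simp add: s_def)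
  have s2: "(s p)\<^sup>2 = 1 / p" if "0 < p" for p using that by (simp add: s_def power_divide)
  have ds: "(s has_real_derivative - (s p ^ 3 / 2)) (at p)" if "0 < p" for p
    unfolding s_def[abs_def] using that
    by (auto intro!: derivative_eq_intros simp: field_simps eval_nat_numeral)
  define I0 where "I0 x = integral {0..x} r" for x
  define I2 where "I2 x = integral {0..x} (\<lambda>t. t\<^sup>2 * r t)" for x
  \<comment> \<open>The second mean value theorem gives integrability of an integrable function
    times a monotone one.\<close>
  have int2: "(\<lambda>t. t\<^sup>2 * r t) integrable_on {0..1}"
    by (rule second_mean_value_theorem_full[OF int, of "\<lambda>t. t\<^sup>2"])
      (auto simp: integrable_on_def intro: power_mono)
  have H: "?H p = I0 (s p) - p * I2 (s p)" if "1 \<le> p" for p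
  proof -
    have sub: "{0..s p} \<subseteq> {0..1}" using s01[OF that] by auto
    have i: "r integrable_on {0..s p}" "(\<lambda>t. t\<^sup>2 * r t) integrable_on {0..s p}"
      using int int2 sub integrable_on_subinterval by blast+
    have "?H p = integral {0..s p} (\<lambda>t. r t - p * (t\<^sup>2 * r t))"
      unfolding section_integral_def s_def by (intro integral_cong) (simp add: algebra_simps)
    also have "\<dots> = I0 (s p) - p * I2 (s p)"
      unfolding I0_def I2_def using i by (subst integral_diff) (auto intro: integrable_on_mult_right)
    finally show ?thesis .
  qed
  have cI0: "continuous_on {0..1} I0" and cI2: "continuous_on {0..1} I2"
    unfolding I0_def I2_def using int int2 by (auto intro: indefinite_integral_continuous_1)
  have cs: "continuous_on {1..} s" unfolding s_def[abs_def] by (intro continuous_intros) auto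
  have cIs: "continuous_on {1..} (\<lambda>p. I0 (s p))" "continuous_on {1..} (\<lambda>p. I2 (s p))"
    using s01 by (auto intro!: continuous_on_compose2[OF cI0 cs] continuous_on_compose2[OF cI2 cs] simp: less_imp_le)
  then have "continuous_on {1..} (\<lambda>p. I0 (s p) - p * I2 (s p))" by (intro continuous_intros)
  then have cH: "continuous_on {1..} ?H" by (rule continuous_on_eq) (simp add: H)
  \<comment> \<open>The values \<open>p > 1\<close> for which \<open>s p\<close> lies strictly
    between \<open>a\<close> and 1.\<close>
  define P where "P = {p. 1 < p \<and> p < 1 / a\<^sup>2}"
  have sP: "a < s p" "s p < 1" "0 < p" "1 < p" if "p \<in> P" for p
  proof -
    show p: "1 < p" "0 < p" using that by (auto simp: P_def)
    show "s p < 1" using p by (simp add: s_def)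
    have "a\<^sup>2 < (s p)\<^sup>2" using that p a unfolding s2[OF p(2)] P_def by (auto simp: field_simps)
    then show "a < s p" using s01[of p] p power2_less_imp_less by force
  qed
  have openP: "open P"
  proof -
    have "P = {1<..<1 / a\<^sup>2}" by (auto simp: P_def)
    then show ?thesis by simp
  qed
  have dr': "(r has_real_derivative r' t) (at t)" if "a < t" "t < 1" for t
  proof -
    have "(r has_real_derivative r' t) (at t within {a<..<1})"
      using dr[of t] that by (auto intro: DERIV_subset)
    then show ?thesis using that by (subst (asm) at_within_open) auto
  qed
  have FTC: "((\<lambda>x. integral {0..x} f) has_real_derivative f t) (at t)"
    if "f integrable_on {0..1}" "isCont f t" "a < t" "t < 1" for f :: "real \<Rightarrow> real" and t
  proof -
    have "((\<lambda>x. integral {0..x} f) has_vector_derivative f t) (at t within {0..1})"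
      using integral_has_vector_derivative_continuous_at[OF that(1), of t "{}"] that a
      by (auto intro: continuous_at_imp_continuous_at_within)
    moreover have "at t within {0..1} = at t"
      using that a by (intro at_within_interior) (auto simp: interior_atLeastAtMost_real)
    ultimately show ?thesis by (simp add: has_real_derivative_iff_has_vector_derivative)
  qed
  have dI0: "(I0 has_real_derivative r t) (at t)" and dI2: "(I2 has_real_derivative t\<^sup>2 * r t) (at t)"
    if "a < t" "t < 1" for t
  proof -
    have "isCont r t" using dr'[OF that] by (rule DERIV_isCont)
    then show "(I0 has_real_derivative r t) (at t)" "(I2 has_real_derivative t\<^sup>2 * r t) (at t)"
      unfolding I0_def[abs_def] I2_def[abs_def]
      using that by (auto intro!: FTC[where f = r] FTC[where f = "\<lambda>t. t\<^sup>2 * r t"] int int2 continuous_intros)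
  qed
  \<comment> \<open>\<open>- M\<close>, \<open>- M'\<close> and \<open>- M''\<close> are the first
    three derivatives of \<open>section_integral r\<close> on \<open>P\<close>.\<close>
  define M where "M p = I2 (s p)" for p
  define M' where "M' p = - (s p ^ 5 * r (s p) / 2)" for p
  define M'' where "M'' p = (5 * s p ^ 7 * r (s p) + s p ^ 8 * r' (s p)) / 4" for p
  have dH: "(?H has_real_derivative - M p) (at p)" if p: "p \<in> P" for p
  proof -
    have "((\<lambda>p. I0 (s p) - p * I2 (s p)) has_real_derivative
       r (s p) * - (s p ^ 3 / 2) - (1 * I2 (s p) + ((s p)\<^sup>2 * r (s p) * - (s p ^ 3 / 2)) * p)) (at p)"
      using sP[OF p] by (intro DERIV_diff DERIV_mult DERIV_ident DERIV_chain2[OF dI0 ds] DERIV_chain2[OF dI2 ds])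
    \<comment> \<open>The integrand \<open>r t * (1 - p * t ^ 2)\<close> vanishes at the upper limit
      \<open>s p\<close>, so the contributions of the moving limit cancel.\<close>
    moreover have "r (s p) * - (s p ^ 3 / 2) - (1 * I2 (s p) + ((s p)\<^sup>2 * r (s p) * - (s p ^ 3 / 2)) * p) = - M p"
      using sP[OF p] by (simp add: s2 M_def)
    moreover have "\<forall>\<^sub>F q in nhds p. ?H q = I0 (s q) - q * I2 (s q)"
      using eventually_nhds_in_open[OF openP p] by eventually_elim (simp add: H P_def)
    ultimately show ?thesis by (simp add: DERIV_cong_ev)
  qed
  have dM: "(M has_real_derivative M' p) (at p)" if p: "p \<in> P" for p
    unfolding M_def[abs_def]
    using DERIV_chain2[OF dI2 ds, of p] sP[OF p] by (simp add: M'_def eval_nat_numeral mult_ac)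
  have dM': "(M' has_real_derivative M'' p) (at p)" if p: "p \<in> P" for p
  proof -
    have "((\<lambda>p. r (s p)) has_real_derivative r' (s p) * - (s p ^ 3 / 2)) (at p)"
      using sP[OF p] by (intro DERIV_chain2[OF dr' ds])
    then show ?thesis
      unfolding M'_def[abs_def] using ds[OF sP(3)[OF p]]
      by (auto intro!: derivative_eq_intros simp: M''_def eval_nat_numeral field_simps)
  qed
  define g' where "g' p = M p / (?H p)\<^sup>2" for p
  define g'' where "g'' p = M' p / (?H p)\<^sup>2 + 2 * (M p)\<^sup>2 / ?H p ^ 3" for p
  define g''' where "g''' p = M'' p / (?H p)\<^sup>2 + 6 * M p * M' p / ?H p ^ 3 + 6 * M p ^ 3 / ?H p ^ 4" for p
  have HP: "?H p \<noteq> 0" if "p \<in> P" for p using pos[of p] sP(4)[OF that] by simp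
  have dg: "((\<lambda>p. 1 / ?H p) has_real_derivative g' p) (at p)" if p: "p \<in> P" for p
    unfolding g'_def using HP[OF p]
    by (auto intro!: derivative_eq_intros dH[OF p] simp: field_simps power2_eq_square)
  have dg': "(g' has_real_derivative g'' p) (at p)" if p: "p \<in> P" for p
    unfolding g'_def[abs_def] g''_def using HP[OF p]
    by (auto intro!: derivative_eq_intros dH[OF p] dM[OF p] simp: field_simps eval_nat_numeral)
  have dg'': "(g'' has_real_derivative g''' p) (at p)" if p: "p \<in> P" for p
    unfolding g''_def[abs_def] g'''_def using HP[OF p]
    by (auto intro!: derivative_eq_intros dH[OF p] dM[OF p] dM'[OF p] simp: field_simps eval_nat_numeral)
  have evP: "\<forall>\<^sub>F p in at_right 1. p \<in> P"
  proof -
    have "1 < 1 / a\<^sup>2" using a by (simp add: power_less_one_iff)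
    then show ?thesis using eventually_at_right_real[of 1 "1 / a\<^sup>2"] by (simp add: P_def)
  qed
  have ls: "(s \<longlongrightarrow> 1) (at_right 1)"
    using ds[of 1] DERIV_isCont s1 by (metis isCont_def filterlim_at_split zero_less_one)
  moreover have "\<forall>\<^sub>F p in at_right 1. s p \<in> {a<..1} \<and> s p \<noteq> 1"
    using evP
  proof eventually_elim
    case (elim p)
    then show ?case using sP(1,2)[OF elim] by simp
  qed
  \<comment> \<open>\<open>s p\<close> tends to 1 from below without reaching it, so limits of
    \<open>r\<close> and \<open>r'\<close> at 1 can be taken along \<open>s\<close>.\<close>
  ultimately have fs: "filterlim s (at 1 within {a<..1}) (at_right 1)"
    unfolding filterlim_at by blast
  have lr: "((\<lambda>p. r (s p)) \<longlongrightarrow> r 1) (at_right 1)"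
    using dr[of 1] a has_field_derivative_imp_has_derivative has_derivative_continuous
    by (intro filterlim_compose[OF _ fs]) (fastforce simp: continuous_within)
  have lr': "((\<lambda>p. r' (s p)) \<longlongrightarrow> r' 1) (at_right 1)"
    by (rule filterlim_compose[OF cr' fs])
  have at1: "at 1 within {1..} = at_right (1::real)" by (simp add: at_within_Ici_at_right)
  have lH: "(?H \<longlongrightarrow> ?H 1) (at_right 1)" and lM: "(M \<longlongrightarrow> k) (at_right 1)"
    using cH cIs(2) by (auto simp: continuous_on_def M_def[abs_def] at1 I2_def s1 k dest!: bspec[of _ _ 1])
  have "(g''' \<longlongrightarrow> (5 * 1 ^ 7 * r 1 + 1 ^ 8 * r' 1) / 4 / (?H 1)\<^sup>2
      + 6 * k * - (1 ^ 5 * r 1 / 2) / ?H 1 ^ 3 + 6 * k ^ 3 / ?H 1 ^ 4) (at_right 1)"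
    unfolding g'''_def[abs_def] M''_def M'_def using pos[of 1]
    by (intro tendsto_intros lr lr' lH lM ls) auto
  \<comment> \<open>Over the common denominator the numerator is the difference of the two sides of
    \<open>neg\<close>.\<close>
  moreover have "(5 * 1 ^ 7 * r 1 + 1 ^ 8 * r' 1) / 4 / (?H 1)\<^sup>2
      + 6 * k * - (1 ^ 5 * r 1 / 2) / ?H 1 ^ 3 + 6 * k ^ 3 / ?H 1 ^ 4 =
      ((?H 1)\<^sup>2 * (5 * r 1 + r' 1) + 24 * k ^ 3 - 12 * ?H 1 * k * r 1) / (4 * ?H 1 ^ 4)"
    using pos[of 1] by (simp add: field_simps eval_nat_numeral)
  moreover have "\<dots> < 0" using neg pos[of 1] by (intro divide_neg_pos) auto
  ultimately have "\<forall>\<^sub>F p in at_right 1. g''' p < 0" by (metis order_tendstoD(2))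
  with evP have "\<forall>\<^sub>F p in at_right 1. g''' p < 0 \<and> p \<in> P" by eventually_elim simp
  then obtain b where b: "1 < b" "\<And>p. 1 < p \<Longrightarrow> p < b \<Longrightarrow> g''' p < 0 \<and> p \<in> P"
    unfolding eventually_at_right_field by blast
  define \<delta> where "\<delta> = (b - 1) / 3"
  have \<delta>: "0 < \<delta>" "1 + 3 * \<delta> = b" using b(1) by (simp_all add: \<delta>_def diff_divide_distrib)
  have shift: "((\<lambda>x. f (1 + x)) has_real_derivative D) (at x)" if "(f has_real_derivative D) (at (1 + x))" for f D and x :: real
    using DERIV_chain2[of f D "\<lambda>x. 1 + x" x 1 UNIV] that by (simp add: DERIV_add[OF DERIV_const DERIV_ident, of 1, simplified])
  have "continuous_on {0..3 * \<delta>} (\<lambda>x. 1 / ?H (1 + x))"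
    using pos by (intro continuous_intros continuous_on_compose2[OF cH]) (auto simp: less_imp_neq[symmetric])
  then obtain \<eta> where \<eta>: "0 < \<eta>" "\<eta> < 2 * \<delta>"
    "1 / ?H (1 + 3 * \<delta>) - 3 * (1 / ?H (1 + 2 * \<delta>)) + 3 * (1 / ?H (1 + \<delta>)) - 1 / ?H (1 + 0)
      = \<delta>\<^sup>2 * (g'' (1 + (\<eta> + \<delta>)) - g'' (1 + \<eta>))"
  proof (rule third_difference_mean_value[OF \<delta>(1)])
    fix x assume "0 < x" "x < 3 * \<delta>"
    then have "1 + x \<in> P" using b(2)[of "1 + x"] \<delta> by auto
    then show "((\<lambda>x. 1 / ?H (1 + x)) has_real_derivative g' (1 + x)) (at x)"
      "((\<lambda>x. g' (1 + x)) has_real_derivative g'' (1 + x)) (at x)"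
      by (auto intro: shift dg dg')
  qed
  have "g'' (1 + (\<eta> + \<delta>)) < g'' (1 + \<eta>)"
  proof (rule DERIV_neg_imp_decreasing[of "1 + \<eta>" "1 + (\<eta> + \<delta>)" g''])
    show "1 + \<eta> < 1 + (\<eta> + \<delta>)" using \<delta> by simp
    fix x assume "1 + \<eta> \<le> x" "x \<le> 1 + (\<eta> + \<delta>)"
    then have "g''' x < 0" "x \<in> P" using b(2)[of x] \<eta> \<delta> by auto
    then show "\<exists>y. (g'' has_real_derivative y) (at x) \<and> y < 0" using dg'' by blast
  qed
  then have "\<delta>\<^sup>2 * (g'' (1 + (\<eta> + \<delta>)) - g'' (1 + \<eta>)) < 0" using \<delta> by (intro mult_pos_neg) auto
  then show thesis using that[OF \<delta>(1)] \<eta>(3) by simp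
qed

section \<open>Zonoids and the main result\<close>

lemma ballmax_nonneg:
  assumes "0 \<le> d" "0 \<le> b"
  shows "0 \<le> ballmax d b"
proof (cases "b \<le> d \<and> 0 < d")
  case True
  have "b ^ 4 / (12 * d ^ 3) \<le> b\<^sup>2 / (2 * d)"
  proof -
    have "b\<^sup>2 * (b\<^sup>2 / (12 * d ^ 3)) \<le> b\<^sup>2 * (d\<^sup>2 / (12 * d ^ 3))"
      using True assms by (intro mult_left_mono divide_right_mono power_mono) auto
    also have "\<dots> = b\<^sup>2 / (12 * d)" using True by (simp add: field_simps eval_nat_numeral)
    also have "\<dots> \<le> b\<^sup>2 / (2 * d)" using True by (intro divide_left_mono) auto
    finally show ?thesis by (simp add: eval_nat_numeral)
  qed
  then show ?thesis using True assms by (simp add: ballmax_def)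
next
  case False
  then show ?thesis using assms by (auto simp: ballmax_def)
qed

text \<open>Along the ray through \<open>\<xi>\<close>, membership of
  \<open>l *\<^sub>R \<xi>\<close> in the intersection body means \<open>l <= V\<close>, and
  membership in the polar of \<open>Z\<close> means \<open>l * h <= 1\<close>. Agreement for all
  \<open>l >= 0\<close> forces \<open>h = 1 / V\<close>.\<close>

lemma support_function_polar_body:
  fixes Z :: "(real^6) set"
  assumes Z: "compact Z" "Z \<noteq> {}" and L: "intersection_body K = polar_body Z"
    and \<xi>: "norm \<xi> = 1" and V: "0 < hyperplane_volume \<xi> (K \<inter> orth_complement \<xi>)"
  shows "support_function Z \<xi> = 1 / hyperplane_volume \<xi> (K \<inter> orth_complement \<xi>)"
proof -
  define V where "V = hyperplane_volume \<xi> (K \<inter> orth_complement \<xi>)"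
  define h where "h = support_function Z \<xi>"
  have V0: "0 < V" using assms by (simp add: V_def)
  have mem1: "l *\<^sub>R \<xi> \<in> intersection_body K \<longleftrightarrow> l \<le> V" if "0 \<le> l" for l
  proof
    assume "l *\<^sub>R \<xi> \<in> intersection_body K"
    then obtain m \<zeta> where m: "l *\<^sub>R \<xi> = m *\<^sub>R \<zeta>" "norm \<zeta> = 1" "0 \<le> m"
      "m \<le> hyperplane_volume \<zeta> (K \<inter> orth_complement \<zeta>)"
      by (auto simp: intersection_body_def)
    have "\<bar>l\<bar> * norm \<xi> = \<bar>m\<bar> * norm \<zeta>" using m(1) by (metis norm_scaleR)
    then have "l = m" using \<xi> m that by simp
    then show "l \<le> V" using m V0 by (cases "l = 0") (auto simp: V_def)
  next
    assume "l \<le> V"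
    then show "l *\<^sub>R \<xi> \<in> intersection_body K"
      using \<xi> that by (auto simp: intersection_body_def V_def)
  qed
  obtain B where B: "\<And>y. y \<in> Z \<Longrightarrow> norm y \<le> B"
    using compact_imp_bounded[OF Z(1)] unfolding bounded_iff by blast
  have bdd: "bdd_above {\<xi> \<bullet> u | u. u \<in> Z}"
  proof (rule bdd_aboveI)
    fix x assume "x \<in> {\<xi> \<bullet> u | u. u \<in> Z}"
    then obtain u where "x = \<xi> \<bullet> u" "u \<in> Z" by blast
    then show "x \<le> B" using norm_cauchy_schwarz[of \<xi> u] B[of u] \<xi> by simp
  qed
  have mem2: "l *\<^sub>R \<xi> \<in> polar_body Z \<longleftrightarrow> l * h \<le> 1" if l: "0 \<le> l" for l
  proof
    assume *: "l *\<^sub>R \<xi> \<in> polar_body Z"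
    show "l * h \<le> 1"
    proof (cases "l = 0")
      case False
      then have "0 < l" using l by simp
      have "h \<le> 1 / l"
        unfolding h_def support_function_def
      proof (rule cSup_least)
        show "{\<xi> \<bullet> u | u. u \<in> Z} \<noteq> {}" using Z(2) by auto
        fix x assume "x \<in> {\<xi> \<bullet> u | u. u \<in> Z}"
        then show "x \<le> 1 / l" using * \<open>0 < l\<close> by (auto simp: polar_body_def field_simps)
      qed
      then show ?thesis using \<open>0 < l\<close> by (simp add: field_simps)
    qed simp
  next
    assume *: "l * h \<le> 1"
    have "l * (\<xi> \<bullet> y) \<le> 1" if "y \<in> Z" for y
    proof -
      have "\<xi> \<bullet> y \<le> h" unfolding h_def support_function_def
        using that by (intro cSup_upper bdd) auto
      then have "l * (\<xi> \<bullet> y) \<le> l * h" using l by (rule mult_left_mono)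
      then show ?thesis using * by linarith
    qed
    then show "l *\<^sub>R \<xi> \<in> polar_body Z" by (simp add: polar_body_def)
  qed
  have iff: "l \<le> V \<longleftrightarrow> l * h \<le> 1" if "0 \<le> l" for l
    using mem1[OF that] mem2[OF that] L by simp
  \<comment> \<open>If \<open>h\<close> were not positive, the whole ray would lie in the polar,
    including the point with \<open>l = V + 1\<close>.\<close>
  have h0: "0 < h"
  proof (rule ccontr)
    assume "\<not> 0 < h"
    then have "(V + 1) * h \<le> 0" using V0 by (simp add: mult_nonneg_nonpos)
    then show False using iff[of "V + 1"] V0 by simp
  qed
  have "V * h \<le> 1" using iff[of V] V0 by simp
  moreover have "1 / h \<le> V" using iff[of "1 / h"] h0 by simp
  ultimately have "h = 1 / V" using h0 V0 by (simp add: field_simps)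
  then show ?thesis by (simp add: h_def V_def)
qed

text \<open>The integral in \<open>int\<close> is the same for all unit vectors \<open>y\<close>, so
  it may be averaged over \<open>y\<close>. After exchanging integrals, each \<open>v\<close>
  contributes a value of \<open>ballmax\<close>, and third differences of these values are
  nonnegative.\<close>

lemma third_difference_zonoid_nonneg:
  fixes \<mu> :: "(real^6) measure" and G :: "real \<Rightarrow> real"
  assumes \<mu>: "even_sphere_measure \<mu>" and f: "hyperplane_isometry e6 f" and \<delta>: "0 < \<delta>"
    and G: "\<And>w. 0 \<le> w \<Longrightarrow> 0 < G w"
    and int: "\<And>w y. 0 \<le> w \<Longrightarrow> norm y = 1 \<Longrightarrow> (\<integral>v. \<bar>(f y + sqrt w *\<^sub>R e6) \<bullet> v\<bar> \<partial>\<mu>) = G w"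
  shows "0 \<le> G (3 * \<delta>) - 3 * G (2 * \<delta>) + 3 * G \<delta> - G 0"
proof -
  have sets: "sets \<mu> = sets (restrict_space borel (sphere 0 1))" and fin: "finite_measure \<mu>"
    using \<mu> by (auto simp: even_sphere_measure_def)
  interpret finite_measure \<mu> by (rule fin)
  interpret P: pair_sigma_finite "lborel :: (real^5) measure" \<mu> ..
  have meas: "g \<in> \<mu> \<rightarrow>\<^sub>M borel" if "g \<in> borel \<rightarrow>\<^sub>M borel" for g :: "real^6 \<Rightarrow> 'b::topological_space"
    using measurable_restrict_space1[OF that] measurable_cong_sets[OF sets refl] by blast
  \<comment> \<open>The adjoint of the isometry takes \<open>v\<close> to the coordinates of its
    projection orthogonal to the axis.\<close>
  define T where "T = adjoint f"
  have lf: "linear f" using f by (simp add: hyperplane_isometry_def)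
  have T: "f y \<bullet> v = T v \<bullet> y" for y v
    using adjoint_works[OF lf, of y v] by (simp add: T_def inner_commute)
  have lT: "linear T" unfolding T_def by (rule adjoint_linear[OF lf])
  have Tm[measurable]: "T \<in> \<mu> \<rightarrow>\<^sub>M borel" by (rule meas[OF borel_measurable_linear[OF lT]])
  have cm[measurable]: "(\<lambda>v. v $ 6) \<in> \<mu> \<rightarrow>\<^sub>M borel"
    by (intro meas borel_measurable_continuous_onI continuous_intros)
  have Bm[measurable]: "(cball 0 1 :: (real^5) set) \<in> sets borel" by simp
  define J where "J w v = ballmax (norm (T v)) (\<bar>v $ 6\<bar> * sqrt w)" for w v
  have J0: "0 \<le> J w v" if "0 \<le> w" for w v
    unfolding J_def using that by (intro ballmax_nonneg) auto
  have Jm: "J w \<in> borel_measurable \<mu>" for w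
    unfolding J_def[abs_def] ballmax_def by measurable
  have J: "has_bochner_integral \<mu> (J w) (2 / 3 * G w)" if w: "0 \<le> w" for w
  proof -
    let ?k = "\<lambda>y v. ennreal \<bar>T v \<bullet> (y /\<^sub>R norm y) + sqrt w * v $ 6\<bar>"
    have inner: "(\<integral>\<^sup>+v. ?k y v \<partial>\<mu>) = ennreal (G w)" if y: "y \<noteq> 0" for y
    proof -
      have eq: "(\<integral>v. \<bar>T v \<bullet> (y /\<^sub>R norm y) + sqrt w * v $ 6\<bar> \<partial>\<mu>) = G w"
        using int[OF w, of "y /\<^sub>R norm y"] y by (simp add: inner_add_left T inner_axis')
      \<comment> \<open>A non-integrable function has Bochner integral 0, which the positivity of
        \<open>G w\<close> excludes.\<close>
      then have "integrable \<mu> (\<lambda>v. \<bar>T v \<bullet> (y /\<^sub>R norm y) + sqrt w * v $ 6\<bar>)"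
        using G[OF w] not_integrable_integral_eq by fastforce
      then show ?thesis using eq by (subst nn_integral_eq_integral) auto
    qed
    have "ennreal (G w) * ennreal (rev_const * (2 / 3)) = (\<integral>\<^sup>+y\<in>cball (0::real^5) 1. ennreal (G w) \<partial>lborel)"
      using emeasure_unit_ball_rev_const by (simp add: nn_integral_cmult_indicator)
    also have "\<dots> = (\<integral>\<^sup>+y. \<integral>\<^sup>+v. ?k y v * indicator (cball 0 1) y \<partial>\<mu> \<partial>lborel)"
    proof (rule nn_integral_cong_AE)
      have "AE y in lborel. y \<noteq> (0::real^5)" by (rule AE_lborel_singleton)
      then show "AE y in lborel. ennreal (G w) * indicator (cball (0::real^5) 1) y = (\<integral>\<^sup>+v. ?k y v * indicator (cball 0 1) y \<partial>\<mu>)"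
      proof eventually_elim
        case (elim y)
        have "(\<integral>\<^sup>+v. ?k y v * indicator (cball 0 1) y \<partial>\<mu>) = (\<integral>\<^sup>+v. ?k y v \<partial>\<mu>) * indicator (cball 0 1) y"
          by (rule nn_integral_multc) measurable
        then show ?case unfolding inner[OF elim] by simp
      qed
    qed
    also have "\<dots> = (\<integral>\<^sup>+v. \<integral>\<^sup>+y. ?k y v * indicator (cball 0 1) y \<partial>lborel \<partial>\<mu>)"
      by (rule P.Fubini'[symmetric]) measurable
    also have "\<dots> = (\<integral>\<^sup>+v. ennreal (rev_const * J w v) \<partial>\<mu>)"
    proof (rule nn_integral_cong)
      fix v
      show "(\<integral>\<^sup>+y. ?k y v * indicator (cball 0 1) y \<partial>lborel) = ennreal (rev_const * J w v)"
        unfolding nn_integral_abs_ball J_def using w by (simp add: abs_mult mult.commute)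
    qed
    also have "\<dots> = ennreal rev_const * (\<integral>\<^sup>+v. ennreal (J w v) \<partial>\<mu>)"
      using rev_const_pos J0[OF w] Jm by (simp add: ennreal_mult nn_integral_cmult)
    finally have "ennreal rev_const * (\<integral>\<^sup>+v. ennreal (J w v) \<partial>\<mu>) = ennreal rev_const * ennreal (2 / 3 * G w)"
      using rev_const_pos G[OF w] by (simp add: mult_ac flip: ennreal_mult)
    then have "(\<integral>\<^sup>+v. ennreal (J w v) \<partial>\<mu>) = ennreal (2 / 3 * G w)"
      using rev_const_pos by (simp add: ennreal_mult_cancel_left)
    then show ?thesis
      using J0[OF w] Jm G[OF w] by (intro has_bochner_integral_nn_integral) auto
  qed
  have bi: "has_bochner_integral \<mu> (\<lambda>v. J (3 * \<delta>) v - 3 * J (2 * \<delta>) v + 3 * J \<delta> v - J 0 v)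
      (2 / 3 * G (3 * \<delta>) - 3 * (2 / 3 * G (2 * \<delta>)) + 3 * (2 / 3 * G \<delta>) - 2 / 3 * G 0)"
    using \<delta> by (intro has_bochner_integral_diff has_bochner_integral_add has_bochner_integral_mult_right J) auto
  have "0 \<le> J (3 * \<delta>) v - 3 * J (2 * \<delta>) v + 3 * J \<delta> v - J 0 v" for v
    unfolding J_def using ballmax_third_difference[of "norm (T v)" "\<bar>v $ 6\<bar>" \<delta>] \<delta> by simp
  then have "0 \<le> (\<integral>v. J (3 * \<delta>) v - 3 * J (2 * \<delta>) v + 3 * J \<delta> v - J 0 v \<partial>\<mu>)"
    by (rule Bochner_Integration.integral_nonneg)
  then have "0 \<le> 2 / 3 * G (3 * \<delta>) - 3 * (2 / 3 * G (2 * \<delta>)) + 3 * (2 / 3 * G \<delta>) - 2 / 3 * G 0"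
    unfolding has_bochner_integral_integral_eq[OF bi] .
  then show ?thesis by simp
qed

theorem proposition4:
  fixes K :: "(real^6) set" and h r :: "real \<Rightarrow> real" and k1 :: real
  assumes "convex_body K" and "origin_symmetric K" and "body_of_revolution K"
    and "\<exists>a. 0 \<le> a \<and> a < 1 \<and> C2_on (radial_profile K) {a<..1}"
    and "\<And>x. x \<in> {0..1} \<Longrightarrow>
           h x = integral {0..x} (\<lambda>t. radial_profile K t ^ 5 * (x\<^sup>2 - t\<^sup>2))"
    and "k1 = integral {0..1} (\<lambda>t. t\<^sup>2 * radial_profile K t ^ 5)"
    and "\<And>t. t \<in> {0..1} \<Longrightarrow> r t = radial_profile K t ^ 5"
    and "(h 1)\<^sup>2 * (5 * r 1 + vector_derivative r (at 1 within {0..1})) + 24 * k1 ^ 3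
           < 12 * h 1 * k1 * r 1"
  shows "\<not> polar_zonoid (intersection_body K)"
proof
  note K = assms(1-3)
  define R where "R t = radial_profile K t ^ 5" for t
  define S where "S = section_integral R"
  assume "polar_zonoid (intersection_body K)"
  then obtain Z where "zonoid Z" and Z3: "intersection_body K = polar_body Z"
    by (auto simp: polar_zonoid_def)
  then obtain \<mu> where Z12: "compact Z" "Z \<noteq> {}" and \<mu>: "even_sphere_measure \<mu>"
    and supp': "\<forall>u\<in>sphere 0 1. support_function Z u = (\<integral>v. \<bar>u \<bullet> v\<bar> \<partial>\<mu>)"
    unfolding zonoid_def by blast
  note Z = Z12 Z3
  have supp: "support_function Z u = (\<integral>v. \<bar>u \<bullet> v\<bar> \<partial>\<mu>)" if "norm u = 1" for u
    using supp' that by simp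
  obtain a0 \<rho>' \<rho>'' where a0: "0 \<le> a0" "a0 < 1"
    and d: "\<forall>t\<in>{a0<..1}. (radial_profile K has_real_derivative \<rho>' t) (at t within {a0<..1})"
      "\<forall>t\<in>{a0<..1}. (\<rho>' has_real_derivative \<rho>'' t) (at t within {a0<..1})"
    using assms(4) unfolding C2_on_def by blast
  note d1 = bspec[OF d(1)] and d2 = bspec[OF d(2)]
  \<comment> \<open>The midpoint of \<open>a0\<close> and 1 is strictly positive even if
    \<open>a0 = 0\<close>, as the third-difference lemma demands.\<close>
  define a where "a = (a0 + 1) / 2"
  have a: "0 < a" "a < 1" "{a<..1} \<subseteq> {a0<..1}" using a0 by (auto simp: a_def)
  define R' where "R' t = 5 * radial_profile K t ^ 4 * \<rho>' t" for t
  have dR: "(R has_real_derivative R' t) (at t within {a<..1})" if "a < t" "t \<le> 1" for t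
  proof -
    have "(radial_profile K has_real_derivative \<rho>' t) (at t within {a<..1})"
      using that a(3) by (auto intro!: DERIV_subset[OF d1 a(3)])
    then show ?thesis
      unfolding R_def[abs_def] R'_def by (auto intro!: derivative_eq_intros)
  qed
  have cR': "(R' \<longlongrightarrow> R' 1) (at 1 within {a<..1})"
  proof -
    have "1 \<in> {a0<..1}" using a0 by simp
    then have "continuous (at 1 within {a<..1}) (radial_profile K)" "continuous (at 1 within {a<..1}) \<rho>'"
      using DERIV_continuous[OF DERIV_subset[OF d1 a(3)]] DERIV_continuous[OF DERIV_subset[OF d2 a(3)]] by blast+
    then show ?thesis
      unfolding R'_def[abs_def] by (auto intro!: tendsto_intros simp: continuous_within)
  qed
  have derivR: "vector_derivative r (at 1 within {0..1}) = R' 1"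
  proof (rule vector_derivative_within)
    show "at (1::real) within {0..1} \<noteq> bot" by (simp add: at_within_Icc_at_left)
    \<comment> \<open>The two sets coincide near 1, so the one-sided derivative in the hypothesis
      can be computed in the smaller one.\<close>
    have "at (1::real) within {a<..1} = at 1 within {0..1}"
      using a by (intro at_within_nhd[of _ "{a<..}"]) auto
    then have "(R has_real_derivative R' 1) (at 1 within {0..1})" using dR[of 1] a by simp
    then have "(r has_real_derivative R' 1) (at 1 within {0..1})"
      by (rule has_field_derivative_transform_within[of _ _ _ _ 1]) (auto simp: R_def assms(7))
    then show "(r has_vector_derivative R' 1) (at 1 within {0..1})"
      by (simp add: has_real_derivative_iff_has_vector_derivative)
  qed
  have h1: "h 1 = S 1" by (simp add: assms(5) S_def section_integral_def R_def)
  have r1: "r 1 = R 1" by (simp add: assms(7) R_def)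
  have k1: "k1 = integral {0..1} (\<lambda>t. t\<^sup>2 * R t)" by (simp add: assms(6) R_def)
  have pos: "0 < S p" and vol: "\<And>\<xi>. norm \<xi> = 1 \<Longrightarrow> (\<xi> $ 6)\<^sup>2 = 1 - 1 / p \<Longrightarrow>
      hyperplane_volume \<xi> (K \<inter> orth_complement \<xi>) = rev_const * sqrt p * S p" if p: "1 \<le> p" for p
  proof -
    \<comment> \<open>A normal direction that realizes the parameter \<open>p\<close>, needed to
      obtain positivity of \<open>S p\<close>.\<close>
    define \<xi> :: "real^6" where "\<xi> = sqrt (1 - (sqrt (1 - 1 / p))\<^sup>2) *\<^sub>R axis 1 1 + sqrt (1 - 1 / p) *\<^sub>R e6"
    have "norm \<xi> = 1"
      unfolding \<xi>_def using p by (intro norm_meridian_point) auto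
    moreover have "(\<xi> $ 6)\<^sup>2 = 1 - 1 / p" using p by (simp add: \<xi>_def axis_def)
    ultimately show "0 < S p"
      using hyperplane_volume_section(2)[OF K p] unfolding S_def R_def[abs_def] by blast
    show "hyperplane_volume \<xi> (K \<inter> orth_complement \<xi>) = rev_const * sqrt p * S p"
      if "norm \<xi> = 1" "(\<xi> $ 6)\<^sup>2 = 1 - 1 / p" for \<xi>
      using hyperplane_volume_section(1)[OF K p that] unfolding S_def R_def[abs_def] .
  qed
  obtain \<delta> where \<delta>: "0 < \<delta>"
    and neg: "1 / S (1 + 3 * \<delta>) - 3 * (1 / S (1 + 2 * \<delta>)) + 3 * (1 / S (1 + \<delta>)) - 1 / S 1 < 0"
  proof (rule third_difference_inverse_section_integral[OF a(1,2) _ dR cR' _ k1, folded S_def])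
    show "R integrable_on {0..1}" unfolding R_def[abs_def] by (rule integrable_profile_power5[OF K])
    show "(S 1)\<^sup>2 * (5 * R 1 + R' 1) + 24 * k1 ^ 3 < 12 * S 1 * k1 * R 1"
      using assms(8) unfolding h1 r1 derivR .
  qed (use pos in auto)
  have e6: "norm e6 = 1" by simp
  then have "e6 \<noteq> 0" by (metis norm_zero zero_neq_one)
  then obtain f where f: "hyperplane_isometry e6 f" using hyperplane_isometry_exists by blast
  \<comment> \<open>The value of the support function of \<open>Z\<close> at
    \<open>f y + sqrt w *\<^sub>R e6\<close>. This vector has norm \<open>sqrt (1 + w)\<close>, and
    its direction belongs to the section parameter \<open>p = 1 + w\<close>.\<close>
  define G where "G w = 1 / (rev_const * S (1 + w))" for w
  have "0 \<le> G (3 * \<delta>) - 3 * G (2 * \<delta>) + 3 * G \<delta> - G 0"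
  proof (rule third_difference_zonoid_nonneg[OF \<mu> f \<delta>])
    show "0 < G w" if "0 \<le> w" for w using pos[of "1 + w"] rev_const_pos that by (simp add: G_def)
    fix w :: real and y :: "real^5"
    assume w: "0 \<le> w" and y: "norm y = 1"
    define x where "x = f y + sqrt w *\<^sub>R e6"
    have fy: "e6 \<bullet> f y = 0" "norm (f y) = 1"
      using f y by (auto simp: hyperplane_isometry_def orth_complement_def)
    have "(norm x)\<^sup>2 = 1 + w"
      unfolding x_def using fy w by (subst norm_add_Pythagorean) (auto simp: orthogonal_def inner_commute)
    then have nx: "norm x = sqrt (1 + w)" by (metis norm_ge_zero real_sqrt_unique)
    have x6: "x $ 6 = sqrt w" using fy(1) by (simp add: x_def inner_axis')
    define \<xi> where "\<xi> = x /\<^sub>R sqrt (1 + w)"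
    have \<xi>1: "norm \<xi> = 1" using w by (simp add: \<xi>_def nx)
    have \<xi>6: "(\<xi> $ 6)\<^sup>2 = 1 - 1 / (1 + w)"
      using w by (simp add: \<xi>_def x6 power_mult_distrib power_inverse field_simps)
    have V: "hyperplane_volume \<xi> (K \<inter> orth_complement \<xi>) = rev_const * sqrt (1 + w) * S (1 + w)"
      using vol[OF _ \<xi>1 \<xi>6] w by simp
    have sp: "0 < sqrt (1 + w)" using w by simp
    have "(\<integral>v. \<bar>\<xi> \<bullet> v\<bar> \<partial>\<mu>) = 1 / (rev_const * sqrt (1 + w) * S (1 + w))"
      using support_function_polar_body[OF Z \<xi>1] supp[OF \<xi>1] V pos[of "1 + w"] rev_const_pos w by simp
    \<comment> \<open>By homogeneity the norm \<open>sqrt (1 + w)\<close> comes out of the integral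
      and cancels the same factor in the section volume.\<close>
    moreover have "(\<integral>v. \<bar>x \<bullet> v\<bar> \<partial>\<mu>) = (\<integral>v. sqrt (1 + w) * \<bar>\<xi> \<bullet> v\<bar> \<partial>\<mu>)"
      using sp by (simp add: \<xi>_def abs_mult)
    ultimately show "(\<integral>v. \<bar>(f y + sqrt w *\<^sub>R e6) \<bullet> v\<bar> \<partial>\<mu>) = G w"
      using sp by (simp add: G_def flip: x_def)
  qed
  moreover have "G (3 * \<delta>) - 3 * G (2 * \<delta>) + 3 * G \<delta> - G 0 =
      (1 / S (1 + 3 * \<delta>) - 3 * (1 / S (1 + 2 * \<delta>)) + 3 * (1 / S (1 + \<delta>)) - 1 / S 1) / rev_const"
    by (simp add: G_def diff_divide_distrib add_divide_distrib mult_ac)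
  ultimately show False using neg rev_const_pos by (simp add: zero_le_divide_iff)
qed

end
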